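(* For all integers $m \geq 93$ and $n \geq 31m$, \[\mu(n,n-m) = 2n - \left\lfloor \frac{n}{m} \right\rfloor.\]
   Context: All digraphs are finite, without loops and without multiple arcs (both arcs $uv$ and $vu$ may be present). For digraphs $D=(V,A)$ and $D'=(V',A')$ with $|V| \leq |V'|$, a packing of $D$ and $D'$ is an injection $f: V \to V'$ such that there is no arc $uv \in A$ with $f(u)f(v) \in A'$; if such an injection exists we say $D$ and $D'$ pack. For integers $n$ and $k$ with $1 \leq k \leq n(n-1)$, $\mu(n,k)$ denotes the smallest number such that there exist digraphs $D$ and $D'$, both on $n$ vertices, with $|A(D)| = k$ and $|A(D')| = \mu(n,k)$ which do not pack. *)

theory Defs
  imports Complex_Main "Graph_Theory.Pair_Digraph"
begin

definition packing :: "'a pair_pre_digraph \<Rightarrow> 'b pair_pre_digraph \<Rightarrow> ('a \<Rightarrow> 'b) \<Rightarrow> bool" where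
  "packing D D' f \<longleftrightarrow>
     f ` pverts D \<subseteq> pverts D' \<and> inj_on f (pverts D) \<and>
     \<not> (\<exists>u v. (u, v) \<in> parcs D \<and> (f u, f v) \<in> parcs D')"

definition pack :: "'a pair_pre_digraph \<Rightarrow> 'b pair_pre_digraph \<Rightarrow> bool" where
  "pack D D' \<longleftrightarrow> (\<exists>f. packing D D' f)"

text \<open>
  The vertices are taken to be natural numbers, which is no restriction for finite
  digraphs (see \<open>mu_le\<close> below). For \<open>1 \<le> k \<le> n * (n - 1)\<close> the set whose least
  element is taken is nonempty (see \<open>mu_attained\<close>); outside that range
  the value has no meaning.
\<close>

definition mu :: "nat \<Rightarrow> nat \<Rightarrow> nat" where
  "mu n k = (LEAST l. \<exists>(D :: nat pair_pre_digraph) (D' :: nat pair_pre_digraph).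
     pair_digraph D \<and> pair_digraph D' \<and>
     card (pverts D) = n \<and> card (pverts D') = n \<and>
     card (parcs D) = k \<and> card (parcs D') = l \<and>
     \<not> pack D D')"

lemma ex_nat_copy:
  fixes D :: "'a pair_pre_digraph"
  assumes "pair_digraph D"
  obtains h :: "'a \<Rightarrow> nat" and E :: "nat pair_pre_digraph"
  where "inj_on h (pverts D)" "pair_digraph E" "pverts E = h ` pverts D"
    "parcs E = map_prod h h ` parcs D"
    "card (pverts E) = card (pverts D)" "card (parcs E) = card (parcs D)"
proof -
  interpret D: pair_digraph D by fact
  obtain h :: "'a \<Rightarrow> nat" where h: "inj_on h (pverts D)"
    using D.pair_finite_verts finite_imp_inj_to_nat_seg by blast
  define E where "E = \<lparr>pverts = h ` pverts D, parcs = map_prod h h ` parcs D\<rparr>"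
  have wf: "u \<in> pverts D" "v \<in> pverts D" "u \<noteq> v" if "(u, v) \<in> parcs D" for u v
    using that D.in_arcsD1 D.in_arcsD2 D.pair_no_loops[of "(u, v)"] by auto
  have hD: "h u = h v \<longleftrightarrow> u = v" if "u \<in> pverts D" "v \<in> pverts D" for u v
    using that h by (auto dest: inj_onD)
  have "pair_digraph E"
  proof (unfold_locales)
    fix e assume "e \<in> parcs E"
    then obtain u v where e: "e = (h u, h v)" "(u, v) \<in> parcs D" by (auto simp: E_def)
    show "fst e \<in> pverts E" "snd e \<in> pverts E" using wf[OF e(2)] e(1) by (auto simp: E_def)
    show "fst e \<noteq> snd e" using wf[OF e(2)] hD e(1) by simp
  qed (use D.pair_finite_verts D.pair_finite_arcs in \<open>simp_all add: E_def\<close>)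
  moreover have "inj_on (map_prod h h) (parcs D)"
  proof (rule inj_onI)
    fix x y assume xy: "x \<in> parcs D" "y \<in> parcs D" "map_prod h h x = map_prod h h y"
    then show "x = y" using wf hD by (cases x; cases y) simp
  qed
  ultimately show ?thesis
    using that[of h E] h by (simp add: E_def card_image)
qed

lemma mu_le:
  fixes D :: "'a pair_pre_digraph" and D' :: "'b pair_pre_digraph"
  assumes D: "pair_digraph D" and D': "pair_digraph D'"
    and n: "card (pverts D) = n" "card (pverts D') = n"
    and np: "\<not> pack D D'"
  shows "mu n (card (parcs D)) \<le> card (parcs D')"
proof -
  obtain h E where h: "inj_on h (pverts D)" and E: "pair_digraph (E :: nat pair_pre_digraph)"
    "pverts E = h ` pverts D" "parcs E = map_prod h h ` parcs D"
    "card (pverts E) = card (pverts D)" "card (parcs E) = card (parcs D)"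
    by (rule ex_nat_copy[OF D])
  obtain h' E' where h': "inj_on h' (pverts D')"
    and E': "pair_digraph (E' :: nat pair_pre_digraph)"
    "pverts E' = h' ` pverts D'" "parcs E' = map_prod h' h' ` parcs D'"
    "card (pverts E') = card (pverts D')" "card (parcs E') = card (parcs D')"
    by (rule ex_nat_copy[OF D'])
  have "\<not> pack E E'"
  proof
    assume "pack E E'"
    then obtain g where g: "g ` pverts E \<subseteq> pverts E'" "inj_on g (pverts E)"
      "\<And>u v. (u, v) \<in> parcs E \<Longrightarrow> (g u, g v) \<notin> parcs E'"
      by (auto simp: pack_def packing_def)
    define i where "i = the_inv_into (pverts D') h'"
    define f where "f = i \<circ> g \<circ> h"
    have i: "i x \<in> pverts D'" "h' (i x) = x" if "x \<in> pverts E'" for x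
      using that h' E'(2) by (auto simp: i_def the_inv_into_f_f)
    have gh: "g (h u) \<in> pverts E'" if "u \<in> pverts D" for u
      using that g(1) E(2) by auto
    have hf: "h' (f u) = g (h u)" if "u \<in> pverts D" for u
      using i gh that by (simp add: f_def)
    have "f ` pverts D \<subseteq> pverts D'"
      using i gh by (auto simp: f_def)
    moreover have "inj_on f (pverts D)"
    proof (rule inj_onI)
      fix u v assume uv: "u \<in> pverts D" "v \<in> pverts D" "f u = f v"
      then have "g (h u) = g (h v)" using hf by metis
      then have "h u = h v" using uv g(2) E(2) by (auto dest: inj_onD)
      then show "u = v" using uv h by (auto dest: inj_onD)
    qed
    moreover have "(f u, f v) \<notin> parcs D'" if uv: "(u, v) \<in> parcs D" for u v
    proof
      assume "(f u, f v) \<in> parcs D'"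
      then have "(h' (f u), h' (f v)) \<in> parcs E'" unfolding E'(3) by force
      moreover have "u \<in> pverts D" "v \<in> pverts D"
        using uv D by (auto simp: pair_digraph_def pair_fin_digraph_def
            dest: pair_wf_digraph.in_arcsD1 pair_wf_digraph.in_arcsD2)
      moreover have "(h u, h v) \<in> parcs E" using uv unfolding E(3) by force
      ultimately show False using g(3) hf by simp
    qed
    ultimately have "packing D D' f" by (auto simp: packing_def)
    then show False using np by (auto simp: pack_def)
  qed
  then show ?thesis
    unfolding mu_def using E E' n by (intro Least_le) metis
qed

lemma mu_attained:
  assumes "1 \<le> k" "k \<le> n * (n - 1)"
  shows "\<exists>(D :: nat pair_pre_digraph) (D' :: nat pair_pre_digraph).
     pair_digraph D \<and> pair_digraph D' \<and>
     card (pverts D) = n \<and> card (pverts D') = n \<and>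
     card (parcs D) = k \<and> card (parcs D') = mu n k \<and>
     \<not> pack D D'"
proof -
  define K where "K = {..<n} \<times> {..<n} - (\<lambda>i. (i, i)) ` {..<n}"
  have K: "e \<in> K \<longleftrightarrow> fst e < n \<and> snd e < n \<and> fst e \<noteq> snd e" for e
    by (cases e) (auto simp: K_def)
  have finK: "finite K" by (simp add: K_def)
  have "card K = card ({..<n} \<times> {..<n}) - card ((\<lambda>i. (i, i)) ` {..<n})"
    unfolding K_def by (rule card_Diff_subset) auto
  then have "card K = n * (n - 1)"
    by (simp add: card_image inj_on_def card_cartesian_product diff_mult_distrib2)
  then obtain A where A: "A \<subseteq> K" "card A = k"
    using assms(2) obtain_subset_with_card_n by metis
  define D where "D = \<lparr>pverts = {..<n}, parcs = A\<rparr>"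
  define D' where "D' = \<lparr>pverts = {..<n}, parcs = K\<rparr>"
  have wf: "pair_digraph D" "pair_digraph D'"
    using A K finK finite_subset[OF A(1) finK]
    by (unfold_locales; auto simp: D_def D'_def)+
  have "\<not> pack D D'"
  proof
    assume "pack D D'"
    then obtain f where f: "f ` {..<n} \<subseteq> {..<n}" "inj_on f {..<n}"
      "\<And>u v. (u, v) \<in> A \<Longrightarrow> (f u, f v) \<notin> K"
      by (auto simp: pack_def packing_def D_def D'_def)
    obtain u v where uv: "(u, v) \<in> A"
      using A(2) assms(1) by (metis card.empty ex_in_conv not_one_le_zero surj_pair)
    then have "u < n" "v < n" "u \<noteq> v" using A(1) K[of "(u, v)"] by auto
    then have "(f u, f v) \<in> K" using f(1,2) K[of "(f u, f v)"] by (auto dest: inj_onD)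
    then show False using f(3) uv by auto
  qed
  then have "\<exists>l (D :: nat pair_pre_digraph) (D' :: nat pair_pre_digraph).
     pair_digraph D \<and> pair_digraph D' \<and>
     card (pverts D) = n \<and> card (pverts D') = n \<and>
     card (parcs D) = k \<and> card (parcs D') = l \<and> \<not> pack D D'"
    using wf A(2) by (intro exI[of _ "card K"] exI[of _ D] exI[of _ D'])
      (simp add: D_def D'_def)
  then show ?thesis unfolding mu_def by (rule LeastI_ex)
qed

end

theory Submission
  imports Defs
begin

text \<open>
  The value is at most \<open>2n - q\<close> with \<open>q = \<lfloor>n/m\<rfloor>\<close>: \<open>m\<close> disjoint out-stars on at least \<open>q\<close> vertices each
  do not pack with a digraph all of whose \<open>2n - q\<close> arcs meet one vertex that has every possible
  in-arc and lacks only \<open>q - 2\<close> out-arcs.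

  For the lower bound a packing of \<open>A\<close> (at most \<open>n - m\<close> arcs) with \<open>A'\<close> (at most \<open>2n - q - 1\<close> arcs)
  is built greedily. Since \<open>A\<close> has \<open>n - m\<close> arcs, it has \<open>m \<ge> 93\<close> disjoint pendant units: isolated
  vertices, or leaves \<open>u\<close> with a neighbour \<open>w\<close> that has at most one neighbour which is not a leaf.
  The few vertices of \<open>A'\<close> of linear degree receive such a \<open>u\<close>, with \<open>w\<close> sent to a vertex of low
  degree that is compatible with it. Giants, i.e. vertices of \<open>A'\<close> that lack less than \<open>n/3\<close> of their
  out-arcs or of their in-arcs, number at most two; they receive a light sink or source of \<open>A\<close>
  instead, and this is where the sharp bound on \<open>card A'\<close> is used. Next the vertices of \<open>A\<close> of degree
  at least 5 go greedily to vertices of \<open>A'\<close> of degree at most 9. A vertex of \<open>A'\<close> that is by then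
  forbidden for too many of the remaining vertices gets the leaf of an unused unit. For the rest an
  exchange argument works: of degree at most 4, it faces degrees at most \<open>n/27\<close> and short
  lists of forbidden images.
\<close>

section \<open>Degrees and neighbours\<close>

definition nbrs :: "('a \<times> 'a) set \<Rightarrow> 'a \<Rightarrow> 'a set" where
  "nbrs A v = {w. (v, w) \<in> A \<or> (w, v) \<in> A}"

definition arc_deg :: "('a \<times> 'a) set \<Rightarrow> 'a \<Rightarrow> nat" where
  "arc_deg A v = card {e \<in> A. fst e = v \<or> snd e = v}"

definition restr :: "('a \<times> 'a) set \<Rightarrow> 'a set \<Rightarrow> ('a \<times> 'a) set" where
  "restr A S = A \<inter> S \<times> S"

lemma nbrs_sym: "w \<in> nbrs A v \<longleftrightarrow> v \<in> nbrs A w"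
  by (auto simp: nbrs_def)

lemma nbrs_irrefl: "irrefl A \<Longrightarrow> v \<notin> nbrs A v"
  by (auto simp: nbrs_def irrefl_def)

lemma nbrs_subset: "A \<subseteq> V \<times> V \<Longrightarrow> nbrs A v \<subseteq> V"
  by (auto simp: nbrs_def)

lemma finite_nbrs: "finite A \<Longrightarrow> finite (nbrs A v)"
  by (rule finite_subset[of _ "fst ` A \<union> snd ` A"]) (force simp: nbrs_def)+

lemma arc_deg_mono: "A \<subseteq> B \<Longrightarrow> finite B \<Longrightarrow> arc_deg A v \<le> arc_deg B v"
  unfolding arc_deg_def by (intro card_mono) auto

lemma card_nbrs_le: assumes "finite A" shows "card (nbrs A v) \<le> arc_deg A v"
proof -
  have "nbrs A v \<subseteq> (\<lambda>e. if fst e = v then snd e else fst e) ` {e \<in> A. fst e = v \<or> snd e = v}"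
  proof
    fix w assume "w \<in> nbrs A v"
    then consider "(v, w) \<in> A" | "(w, v) \<in> A" "w \<noteq> v" by (auto simp: nbrs_def)
    then show "w \<in> (\<lambda>e. if fst e = v then snd e else fst e) ` {e \<in> A. fst e = v \<or> snd e = v}"
    proof cases
      case 1 then show ?thesis by (intro image_eqI[of _ _ "(v, w)"]) auto
    next
      case 2 then show ?thesis by (intro image_eqI[of _ _ "(w, v)"]) auto
    qed
  qed
  then show ?thesis
    unfolding arc_deg_def by (rule surj_card_le[rotated]) (use assms in simp)
qed

lemma restr_subset: "restr A S \<subseteq> A" "restr A S \<subseteq> S \<times> S"
  by (auto simp: restr_def)

lemma finite_restr: "finite A \<Longrightarrow> finite (restr A S)"
  by (simp add: restr_def)

lemma irrefl_restr: "irrefl A \<Longrightarrow> irrefl (restr A S)"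
  by (auto simp: restr_def irrefl_def)

lemma nbrs_restr: "v \<in> S \<Longrightarrow> nbrs (restr A S) v = nbrs A v \<inter> S"
  by (auto simp: nbrs_def restr_def)

lemma arc_deg_restr_le: "finite A \<Longrightarrow> arc_deg (restr A S) v \<le> arc_deg A v"
  by (rule arc_deg_mono) (auto simp: restr_def)

lemma card_restr_delete:
  assumes "A \<subseteq> V \<times> V" "finite A"
  shows "card (restr A (V - {x})) + arc_deg A x = card A"
proof -
  have "A = restr A (V - {x}) \<union> {e \<in> A. fst e = x \<or> snd e = x}"
    using assms by (auto simp: restr_def)
  moreover have "restr A (V - {x}) \<inter> {e \<in> A. fst e = x \<or> snd e = x} = {}"
    by (auto simp: restr_def)
  ultimately show ?thesis
    unfolding arc_deg_def using assms(2) by (metis (no_types, lifting) card_Un_disjoint finite_Un)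
qed

lemma arc_deg_eq_sum: "finite A \<Longrightarrow> arc_deg A v = (\<Sum>e\<in>A. if fst e = v \<or> snd e = v then 1 else 0)"
  unfolding arc_deg_def by (subst card_eq_sum) (simp add: sum.If_cases Int_def)

lemma sum_arc_deg_le:
  assumes "finite V" "finite A"
  shows "(\<Sum>v\<in>V. arc_deg A v) \<le> 2 * card A"
proof -
  have "(\<Sum>v\<in>V. arc_deg A v) = (\<Sum>e\<in>A. \<Sum>v\<in>V. if fst e = v \<or> snd e = v then 1 else 0)"
    using assms(2) by (simp add: arc_deg_eq_sum sum.swap[of _ V A])
  also have "\<dots> \<le> (\<Sum>e\<in>A. 2)"
  proof (rule sum_mono)
    fix e
    have "(\<Sum>v\<in>V. if fst e = v \<or> snd e = v then 1 else 0) = card {v \<in> V. fst e = v \<or> snd e = v}"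
      using assms(1) by (subst card_eq_sum) (simp add: sum.If_cases Int_def)
    also have "\<dots> \<le> card {fst e, snd e}" by (intro card_mono) auto
    also have "\<dots> \<le> 2" by (simp add: card_insert_if)
    finally show "(\<Sum>v\<in>V. if fst e = v \<or> snd e = v then 1 else 0) \<le> (2::nat)" .
  qed
  finally show ?thesis by simp
qed

lemma card_mult_le_sum:
  fixes f :: "'a \<Rightarrow> nat"
  assumes "finite V" "S \<subseteq> V" "\<And>v. v \<in> S \<Longrightarrow> c \<le> f v"
  shows "card S * c \<le> (\<Sum>v\<in>V. f v)"
proof -
  have "card S * c \<le> (\<Sum>v\<in>S. f v)" using sum_mono[of S "\<lambda>_. c" f] assms by simp
  also have "\<dots> \<le> (\<Sum>v\<in>V. f v)" using assms by (intro sum_mono2) auto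
  finally show ?thesis .
qed

section \<open>Exchange argument and greedy placement\<close>

text \<open>
  In a bijection with fewest conflicts, let \<open>u\<close> be involved in a conflict. The left-hand side of the
  size condition bounds the number of \<open>w\<close> for which exchanging the images of \<open>u\<close> and \<open>w\<close> creates a
  new conflict or fails to remove the old one.
\<close>

lemma swap_packing:
  fixes N :: "'a \<Rightarrow> 'a set" and M :: "'b \<Rightarrow> 'b set" and F :: "'a \<Rightarrow> 'b set"
  assumes fin: "finite A" "finite B" and cAB: "card A = card B"
    and symN: "\<And>u v. v \<in> N u \<longleftrightarrow> u \<in> N v" and irrN: "\<And>u. u \<notin> N u"
    and symM: "\<And>u v. v \<in> M u \<longleftrightarrow> u \<in> M v" and irrM: "\<And>u. u \<notin> M u"
    and degN: "\<And>u. u \<in> A \<Longrightarrow> card (N u \<inter> A) \<le> d"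
    and degM: "\<And>b. b \<in> B \<Longrightarrow> card (M b \<inter> B) \<le> t"
    and row: "\<And>u. u \<in> A \<Longrightarrow> card (F u \<inter> B) \<le> \<alpha>"
    and col: "\<And>b. b \<in> B \<Longrightarrow> card {u \<in> A. b \<in> F u} \<le> \<beta>"
    and big: "\<alpha> + \<beta> + 2 * d * t + d < card A"
  shows "\<exists>f. bij_betw f A B \<and> (\<forall>u\<in>A. f u \<notin> F u) \<and> (\<forall>u\<in>A. \<forall>v\<in>A. v \<in> N u \<longrightarrow> f v \<notin> M (f u))"
proof -
  define conf where "conf f = {(u, v). u \<in> A \<and> v \<in> A \<and> v \<in> N u \<and> f v \<in> M (f u)}
      \<union> {(u, v). u \<in> A \<and> u = v \<and> f u \<in> F u}" for f :: "'a \<Rightarrow> 'b"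
  have finconf: "finite (conf f)" for f
    by (rule finite_subset[of _ "A \<times> A"]) (use fin in \<open>auto simp: conf_def\<close>)
  obtain f0 where f0: "bij_betw f0 A B" using fin cAB finite_same_card_bij by blast
  obtain f where f: "bij_betw f A B"
    and least: "\<And>g. bij_betw g A B \<Longrightarrow> card (conf f) \<le> card (conf g)"
    using ex_has_least_nat[of "\<lambda>f. bij_betw f A B" f0 "\<lambda>f. card (conf f)"] f0 by auto
  have injf: "inj_on f A" and fB: "f ` A = B" using f by (auto simp: bij_betw_def)
  have pre: "card {w \<in> A. f w \<in> S} \<le> card (S \<inter> B)" for S
  proof -
    have "card {w \<in> A. f w \<in> S} = card (f ` {w \<in> A. f w \<in> S})"
      by (rule card_image[symmetric]) (rule inj_on_subset[OF injf], auto)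
    also have "\<dots> \<le> card (S \<inter> B)" using fin fB by (intro card_mono) auto
    finally show ?thesis .
  qed
  have "conf f = {}"
  proof (rule ccontr)
    assume "conf f \<noteq> {}"
    then obtain u v where uv: "(u, v) \<in> conf f" by auto
    then have u: "u \<in> A" by (auto simp: conf_def)
    have fu: "f u \<in> B" using u fB by auto
    define B1 where "B1 = {w \<in> A. f w \<in> F u}"
    define B2 where "B2 = {w \<in> A. f u \<in> F w}"
    define B3 where "B3 = (\<Union>z\<in>N u \<inter> A. {w \<in> A. f w \<in> M (f z)})"
    define B4 where "B4 = (\<Union>z\<in>{z \<in> A. f z \<in> M (f u)}. N z \<inter> A)"
    define bad where "bad = B1 \<union> B2 \<union> B3 \<union> B4 \<union> (N u \<inter> A)"
    have c1: "card B1 \<le> \<alpha>" using pre[of "F u"] row[OF u] by (simp add: B1_def)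
    have c2: "card B2 \<le> \<beta>" using col[OF fu] by (simp add: B2_def)
    have "card B3 \<le> (\<Sum>z\<in>N u \<inter> A. card {w \<in> A. f w \<in> M (f z)})"
      unfolding B3_def using fin by (intro card_UN_le) auto
    also have "\<dots> \<le> (\<Sum>z\<in>N u \<inter> A. t)"
      using pre degM fB by (intro sum_mono) (meson IntD2 imageI order_trans subset_iff equalityD1)
    also have "\<dots> \<le> d * t" using degN[OF u] by simp
    finally have c3: "card B3 \<le> d * t" .
    have "card B4 \<le> (\<Sum>z\<in>{z \<in> A. f z \<in> M (f u)}. card (N z \<inter> A))"
      unfolding B4_def using fin by (intro card_UN_le) auto
    also have "\<dots> \<le> (\<Sum>z\<in>{z \<in> A. f z \<in> M (f u)}. d)"
      using degN by (intro sum_mono) auto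
    also have "\<dots> \<le> t * d" using pre[of "M (f u)"] degM[OF fu] by simp
    finally have c4: "card B4 \<le> t * d" .
    have "card bad \<le> card B1 + card B2 + card B3 + card B4 + card (N u \<inter> A)"
      unfolding bad_def by (meson add_le_mono1 card_Un_le order_trans)
    moreover have "t * d = d * t" "2 * d * t = d * t + d * t" by simp_all
    ultimately have "card bad < card A"
      using c1 c2 c3 c4 degN[OF u] big by linarith
    moreover have "bad \<subseteq> A" by (auto simp: bad_def B1_def B2_def B3_def B4_def)
    ultimately obtain w where w: "w \<in> A" "w \<notin> bad"
      by (metis less_irrefl subsetI subset_antisym)
    have "u \<in> bad"
      using uv u symM by (auto simp: conf_def bad_def B1_def B3_def)
    then have wu: "w \<noteq> u" using w by auto
    define g where "g = f(u := f w, w := f u)"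
    have injg: "inj_on g A"
      using injf u w(1) wu unfolding g_def inj_on_def by auto
    moreover have "g ` A \<subseteq> B" using fB u w(1) by (auto simp: g_def)
    ultimately have bg: "bij_betw g A B"
      using cAB fin card_image card_subset_eq by (metis bij_betw_def)
    have g: "g u = f w" "g w = f u" "\<And>z. z \<noteq> u \<Longrightarrow> z \<noteq> w \<Longrightarrow> g z = f z"
      using wu by (auto simp: g_def)
    have nw: "f w \<notin> F u" "f u \<notin> F w" "w \<notin> N u" "u \<notin> N w"
      "\<And>z. z \<in> N u \<Longrightarrow> z \<in> A \<Longrightarrow> f w \<notin> M (f z)"
      "\<And>z. z \<in> N w \<Longrightarrow> z \<in> A \<Longrightarrow> f z \<notin> M (f u)"
      using w symN symM by (auto simp: bad_def B1_def B2_def B3_def B4_def)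
    have sub: "(x, y) \<in> conf f \<and> x \<noteq> u" if xy: "(x, y) \<in> conf g" for x y
    proof (cases "x = y")
      case True
      then have "x \<in> A" "g x \<in> F x" using xy irrN by (auto simp: conf_def)
      moreover then have "x \<noteq> u" "x \<noteq> w" using nw g by auto
      ultimately show ?thesis using g True by (auto simp: conf_def)
    next
      case False
      then have c: "x \<in> A" "y \<in> A" "y \<in> N x" "g y \<in> M (g x)" using xy by (auto simp: conf_def)
      then have c': "x \<in> N y" "g x \<in> M (g y)" using symN symM by auto
      have "x \<noteq> u"
      proof
        assume "x = u"
        then have "y \<noteq> u" "y \<noteq> w" using c nw False by auto
        then show False using nw(5)[of y] c c' g \<open>x = u\<close> by auto
      qed
      moreover have "x \<noteq> w"
      proof
        assume "x = w"
        then have "y \<noteq> u" "y \<noteq> w" using c nw False by auto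
        then show False using nw(6)[of y] c c' g \<open>x = w\<close> by auto
      qed
      moreover have "y \<noteq> u"
      proof
        assume "y = u"
        then show False using nw(5)[of x] c c' g \<open>x \<noteq> u\<close> \<open>x \<noteq> w\<close> by auto
      qed
      moreover have "y \<noteq> w"
      proof
        assume "y = w"
        then show False using nw(6)[of x] c c' g \<open>x \<noteq> u\<close> \<open>x \<noteq> w\<close> by auto
      qed
      ultimately show ?thesis using c g by (auto simp: conf_def)
    qed
    have "conf g \<subseteq> conf f" using sub by auto
    moreover have "(u, v) \<notin> conf g" using sub by blast
    ultimately have "conf g \<subset> conf f" using uv by blast
    then have "card (conf g) < card (conf f)" by (rule psubset_card_mono[OF finconf])
    then show False using least[OF bg] by simp
  qed
  then have "f u \<notin> F u" "v \<in> N u \<Longrightarrow> f v \<notin> M (f u)" if "u \<in> A" "v \<in> A" for u v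
    using that unfolding conf_def by blast+
  then show ?thesis using f by blast
qed

definition placed :: "('a \<times> 'a) set \<Rightarrow> ('b \<times> 'b) set \<Rightarrow> 'b set \<Rightarrow> 'a set \<Rightarrow> ('a \<Rightarrow> 'b) \<Rightarrow> bool" where
  "placed A A' Y L f \<longleftrightarrow> inj_on f L \<and> f ` L \<subseteq> Y \<and> (\<forall>u\<in>L. \<forall>v\<in>L. v \<in> nbrs A u \<longrightarrow> f v \<notin> nbrs A' (f u))"

lemma placed_extend_one:
  assumes "placed A A' Y L f" "finite L" "finite Y" "finite A'" "irrefl A" "v \<notin> L" "Al \<subseteq> Y"
    and low: "\<And>y. y \<in> Y \<Longrightarrow> card (nbrs A' y) \<le> T"
    and room: "card L + T * card (nbrs A v \<inter> L) < card Al"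
  shows "\<exists>y\<in>Al. placed A A' Y (insert v L) (f(v := y))"
proof -
  define B where "B = f ` L \<union> (\<Union>w\<in>nbrs A v \<inter> L. nbrs A' (f w))"
  have f: "inj_on f L" "f ` L \<subseteq> Y" "\<And>u v. u \<in> L \<Longrightarrow> v \<in> L \<Longrightarrow> v \<in> nbrs A u \<Longrightarrow> f v \<notin> nbrs A' (f u)"
    using assms(1) by (auto simp: placed_def)
  have "card (\<Union>w\<in>nbrs A v \<inter> L. nbrs A' (f w)) \<le> (\<Sum>w\<in>nbrs A v \<inter> L. card (nbrs A' (f w)))"
    using assms(2) by (intro card_UN_le) auto
  also have "\<dots> \<le> (\<Sum>w\<in>nbrs A v \<inter> L. T)" using low f(2) by (intro sum_mono) auto
  finally have "card (\<Union>w\<in>nbrs A v \<inter> L. nbrs A' (f w)) \<le> T * card (nbrs A v \<inter> L)"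
    by (simp add: mult.commute)
  moreover have "card (f ` L) \<le> card L" using assms(2) by (rule card_image_le)
  moreover have "card B \<le> card (f ` L) + card (\<Union>w\<in>nbrs A v \<inter> L. nbrs A' (f w))"
    unfolding B_def by (rule card_Un_le)
  ultimately have "card B < card Al" using room by linarith
  moreover have "finite B" unfolding B_def using assms(2,4) by (auto simp: finite_nbrs)
  ultimately obtain y where y: "y \<in> Al" "y \<notin> B"
    by (metis card_mono linorder_not_less subsetI)
  have "inj_on (f(v := y)) (insert v L)"
    using f(1) y assms(6) by (auto simp: B_def inj_on_def)
  moreover have "(f(v := y)) ` insert v L \<subseteq> Y" using f(2) y assms(6,7) by auto
  moreover have "(f(v := y)) b \<notin> nbrs A' ((f(v := y)) a)"
    if ab: "a \<in> insert v L" "b \<in> insert v L" "b \<in> nbrs A a" for a b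
  proof -
    have ba: "a \<in> nbrs A b" using ab nbrs_sym by metis
    have "a \<noteq> b" using ab nbrs_irrefl[OF assms(5)] by auto
    then consider "a = v" "b \<noteq> v" "b \<in> L" | "b = v" "a \<noteq> v" "a \<in> L" | "a \<noteq> v" "b \<noteq> v" "a \<in> L" "b \<in> L"
      using ab by auto
    then show ?thesis
    proof cases
      case 1
      then have "y \<notin> nbrs A' (f b)" using y ab by (auto simp: B_def)
      then show ?thesis using 1 nbrs_sym by (metis fun_upd_other fun_upd_same)
    next
      case 2
      then have "y \<notin> nbrs A' (f a)" using y ba by (auto simp: B_def)
      then show ?thesis using 2 by auto
    next
      case 3
      then show ?thesis using f(3) ab by auto
    qed
  qed
  ultimately show ?thesis using y(1) unfolding placed_def by blast
qed

lemma placed_extend: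
  assumes "finite S" "placed A A' Y L f" "finite L" "S \<inter> L = {}" "finite Y" "finite A'" "irrefl A"
    and low: "\<And>y. y \<in> Y \<Longrightarrow> card (nbrs A' y) \<le> T"
    and Al: "\<And>v. v \<in> S \<Longrightarrow> Al v \<subseteq> Y"
    and room: "\<And>v. v \<in> S \<Longrightarrow> card (L \<union> S) + T * card (nbrs A v \<inter> (L \<union> S)) \<le> card (Al v)"
  shows "\<exists>g. placed A A' Y (L \<union> S) g \<and> (\<forall>v\<in>L. g v = f v) \<and> (\<forall>v\<in>S. g v \<in> Al v)"
proof -
  have "\<exists>g. placed A A' Y (L \<union> S') g \<and> (\<forall>v\<in>L. g v = f v) \<and> (\<forall>v\<in>S'. g v \<in> Al v)"
    if "finite S'" "S' \<subseteq> S" for S'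
    using that
  proof (induction S' rule: finite_induct)
    case empty
    then show ?case using assms(2) by auto
  next
    case (insert v S')
    then obtain g where g: "placed A A' Y (L \<union> S') g" "\<And>w. w \<in> L \<Longrightarrow> g w = f w" "\<And>w. w \<in> S' \<Longrightarrow> g w \<in> Al w"
      by auto
    have v: "v \<notin> L \<union> S'" "v \<in> S" using insert assms(4) by auto
    have "card (L \<union> S') < card (L \<union> S)"
      using v insert(4) assms(1,3) by (intro psubset_card_mono) auto
    moreover have "card (nbrs A v \<inter> (L \<union> S')) \<le> card (nbrs A v \<inter> (L \<union> S))"
      using insert(4) assms(1,3) by (intro card_mono) auto
    then have "T * card (nbrs A v \<inter> (L \<union> S')) \<le> T * card (nbrs A v \<inter> (L \<union> S))" by simp
    ultimately have "card (L \<union> S') + T * card (nbrs A v \<inter> (L \<union> S')) < card (Al v)"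
      using room[OF v(2)] by linarith
    then obtain y where y: "y \<in> Al v" "placed A A' Y (insert v (L \<union> S')) (g(v := y))"
      using placed_extend_one[OF g(1) _ assms(5,6,7) v(1) Al[OF v(2)] low] insert(1) assms(3) by auto
    define h where "h = g(v := y)"
    have "placed A A' Y (L \<union> insert v S') h" using y(2) by (simp add: h_def)
    moreover have "\<forall>w\<in>L. h w = f w" "\<forall>w\<in>insert v S'. h w \<in> Al w"
      using g(2,3) y(1) v by (auto simp: h_def)
    ultimately show ?case by blast
  qed
  then show ?thesis using assms(1) by auto
qed

lemma peel:
  assumes "finite V" "A \<subseteq> V \<times> V"
  shows "\<exists>X\<subseteq>V. card X * (t + 1) \<le> card A \<and> (\<forall>v\<in>V - X. arc_deg (restr A (V - X)) v \<le> t)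
    \<and> (\<forall>x\<in>X. t < arc_deg A x)"
  using assms
proof (induction "card V" arbitrary: V A)
  case 0
  then show ?case by auto
next
  case (Suc k)
  have finA: "finite A" using Suc(3,4) finite_subset by blast
  show ?case
  proof (cases "\<exists>x\<in>V. t < arc_deg A x")
    case False
    have "restr A (V - {}) = A" using Suc(4) by (auto simp: restr_def)
    then show ?thesis using False by (intro exI[of _ "{}"]) (auto simp: not_less)
  next
    case True
    then obtain x where x: "x \<in> V" "t < arc_deg A x" by auto
    have "k = card (V - {x})" using Suc(2,3) x by simp
    then obtain X where X: "X \<subseteq> V - {x}" "card X * (t + 1) \<le> card (restr A (V - {x}))"
      "\<forall>v\<in>V - {x} - X. arc_deg (restr (restr A (V - {x})) (V - {x} - X)) v \<le> t"
      "\<forall>y\<in>X. t < arc_deg (restr A (V - {x})) y"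
      using Suc(1)[of "V - {x}" "restr A (V - {x})"] Suc(3) restr_subset(2) by (metis finite_Diff)
    have "card (insert x X) = card X + 1"
      using X(1) Suc(3) finite_subset by (subst card_insert_disjoint) auto
    then have "card (insert x X) * (t + 1) \<le> card A"
      using X(2) x(2) card_restr_delete[OF Suc(4) finA, of x] by (simp add: algebra_simps)
    moreover have "restr (restr A (V - {x})) (V - {x} - X) = restr A (V - insert x X)"
      "V - {x} - X = V - insert x X"
      by (auto simp: restr_def)
    moreover have "\<forall>y\<in>X. t < arc_deg A y"
      using X(4) arc_deg_restr_le[OF finA] by (meson less_le_trans)
    ultimately show ?thesis using X x by (intro exI[of _ "insert x X"]) auto
  qed
qed

lemma independent_subset:
  assumes "finite A" "finite B" "3 \<le> T"
  shows "\<exists>Y\<subseteq>B. restr A Y = {} \<and> (\<forall>y\<in>Y. arc_deg A y \<le> T) \<and>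
    card B + card {v. T < arc_deg A v} \<le> card Y + card A"
proof -
  define H where "H = {v. T < arc_deg A v}"
  define E where "E = {e \<in> A. fst e \<notin> H \<and> snd e \<notin> H}"
  define Y where "Y = B - H - fst ` E"
  have "H \<subseteq> fst ` A \<union> snd ` A"
  proof
    fix v assume "v \<in> H"
    then have "card {e \<in> A. fst e = v \<or> snd e = v} \<noteq> 0" by (simp add: H_def arc_deg_def)
    then have "{e \<in> A. fst e = v \<or> snd e = v} \<noteq> {}" by (metis card.empty)
    then obtain a b where "(a, b) \<in> A" "a = v \<or> b = v" by auto
    then show "v \<in> fst ` A \<union> snd ` A" by (metis UnCI fst_conv imageI snd_conv)
  qed
  then have finH: "finite H" using assms(1) finite_subset by blast
  have "card H * (T + 1) \<le> (\<Sum>v\<in>H. arc_deg (A - E) v)"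
  proof (rule card_mult_le_sum[OF finH order_refl])
    fix v assume v: "v \<in> H"
    then have "{e \<in> A - E. fst e = v \<or> snd e = v} = {e \<in> A. fst e = v \<or> snd e = v}"
      by (auto simp: E_def)
    then have "arc_deg (A - E) v = arc_deg A v" by (simp add: arc_deg_def)
    then show "T + 1 \<le> arc_deg (A - E) v" using v by (simp add: H_def)
  qed
  also have "\<dots> \<le> 2 * card (A - E)" using assms(1) finH by (intro sum_arc_deg_le) auto
  finally have "card H * (T + 1) \<le> 2 * card (A - E)" .
  moreover have "card H * 4 \<le> card H * (T + 1)" using assms(3) by (intro mult_le_mono) auto
  ultimately have "2 * card H \<le> card (A - E)" by linarith
  moreover have "card A = card (A - E) + card E"
    using assms(1) card_Diff_subset[of E A] card_mono[of A E] finite_subset[of E A] by (auto simp: E_def)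
  moreover have "card (fst ` E) \<le> card E"
    using assms(1) by (intro card_image_le) (auto simp: E_def)
  moreover have "card B \<le> card Y + card H + card (fst ` E)"
  proof -
    have "B \<subseteq> Y \<union> H \<union> fst ` E" by (auto simp: Y_def)
    then have "card B \<le> card (Y \<union> H \<union> fst ` E)"
      using assms finH by (intro card_mono) (auto simp: Y_def E_def)
    then show ?thesis using card_Un_le[of "Y \<union> H" "fst ` E"] card_Un_le[of Y H] by linarith
  qed
  ultimately have "card B + card H \<le> card Y + card A" by linarith
  moreover have "restr A Y = {}" by (force simp: restr_def Y_def E_def)
  moreover have "\<forall>y\<in>Y. arc_deg A y \<le> T" by (auto simp: Y_def H_def)
  ultimately show ?thesis unfolding H_def by (intro exI[of _ Y]) (auto simp: Y_def)
qed

lemma card_high: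
  assumes "finite V" "finite A"
  shows "card {v \<in> V. T < arc_deg A v} * (T + 1) \<le> 2 * card A"
proof -
  have "card {v \<in> V. T < arc_deg A v} * (T + 1) \<le> (\<Sum>v\<in>V. arc_deg A v)"
    by (rule card_mult_le_sum[OF assms(1)]) auto
  then show ?thesis using sum_arc_deg_le[OF assms] by linarith
qed

lemma nbrs_arc_deg_1:
  assumes "irrefl A" "finite A" "arc_deg A u = 1"
  shows "\<exists>w. nbrs A u = {w} \<and> w \<noteq> u"
proof -
  obtain e where e: "{e \<in> A. fst e = u \<or> snd e = u} = {e}"
    using assms(3) unfolding arc_deg_def by (rule card_1_singletonE)
  obtain a b where ab: "e = (a, b)" by (cases e)
  have "(a, b) \<in> {e \<in> A. fst e = u \<or> snd e = u}" using e ab by simp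
  then have "(a, b) \<in> A" "a = u \<or> b = u" by simp_all
  moreover have "a \<noteq> b" using calculation assms(1) by (auto simp: irrefl_def)
  moreover have "(u, w) \<in> A \<longleftrightarrow> (u, w) = (a, b)" "(w, u) \<in> A \<longleftrightarrow> (w, u) = (a, b)" for w
    using eqset_imp_iff[OF e, of "(u, w)"] eqset_imp_iff[OF e, of "(w, u)"] ab by simp_all
  ultimately show ?thesis by (intro exI[of _ "if a = u then b else a"]) (auto simp: nbrs_def)
qed

lemma nbrs_arc_deg_0: "finite A \<Longrightarrow> arc_deg A u = 0 \<Longrightarrow> nbrs A u = {}"
  using card_nbrs_le[of A u] finite_nbrs[of A u] by simp

section \<open>Pendant units\<close>

text \<open>
  Discharging: give every vertex the charge \<open>2 - arc_deg A v\<close>, of total at least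
  \<open>2 * (card V - card A)\<close>, and let every leaf pass its charge to its neighbour. Then only isolated vertices,
  components with a single arc, and vertices \<open>w\<close> with at most one arc to a non-leaf keep positive charge.
\<close>

lemma pendant_units:
  fixes V :: "'a::linorder set"
  assumes "finite V" "A \<subseteq> V \<times> V" "irrefl A"
  shows "\<exists>U\<subseteq>V. card V \<le> card U + card A \<and> (\<forall>u\<in>U. arc_deg A u \<le> 1) \<and>
    (\<forall>u\<in>U. nbrs A u \<inter> U = {}) \<and>
    (\<forall>u\<in>U. \<forall>v\<in>U. u \<noteq> v \<longrightarrow> nbrs A u \<inter> nbrs A v = {}) \<and>
    (\<forall>u\<in>U. \<forall>w\<in>nbrs A u. card {v \<in> nbrs A w. arc_deg A v \<noteq> 1} \<le> 1)"
proof -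
  have finA: "finite A" using assms finite_subset by blast
  define d where "d = arc_deg A"
  define Lf where "Lf = {v \<in> V. d v = 1}"
  define lf where "lf w = card (nbrs A w \<inter> Lf)" for w
  define iso where "iso = {v \<in> V. d v = 0}"
  define K where "K = {v \<in> Lf. nbrs A v \<inter> Lf \<noteq> {}}"
  define K2 where "K2 = {v \<in> K. \<forall>w\<in>nbrs A v. v < w}"
  define G where "G = {v \<in> V. 2 \<le> d v}"
  define cen where "cen = {w \<in> G. d w \<le> lf w + 1}"
  have fins: "finite Lf" "finite iso" "finite K" "finite K2" "finite G" "finite cen"
    using assms(1) by (auto simp: Lf_def iso_def K_def K2_def G_def cen_def)
  have nV: "nbrs A v \<subseteq> V" for v using assms(2) by (rule nbrs_subset)
  have single: "\<exists>w. nbrs A u = {w} \<and> w \<noteq> u" if "u \<in> Lf" for u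
    using nbrs_arc_deg_1[OF assms(3) finA] that by (auto simp: Lf_def d_def)
  have uniq: "nbrs A u = {w}" if "u \<in> Lf" "w \<in> nbrs A u" for u w
    using single[OF that(1)] that(2) by auto
  have nd: "card (nbrs A v) \<le> d v" for v using card_nbrs_le[OF finA] by (simp add: d_def)
  have lfd: "lf w \<le> d w" for w
    unfolding lf_def using nd[of w] card_mono[OF finite_nbrs[OF finA], of "nbrs A w \<inter> Lf" w] by auto
  define l where "l w = (SOME u. u \<in> nbrs A w \<inter> Lf)" for w
  have l: "l w \<in> Lf" "nbrs A (l w) = {w}" if "w \<in> cen" for w
  proof -
    have "lf w \<noteq> 0" using that by (auto simp: cen_def G_def)
    then have "nbrs A w \<inter> Lf \<noteq> {}" by (auto simp: lf_def)
    then have "l w \<in> nbrs A w \<inter> Lf" unfolding l_def by (rule some_in_eq[THEN iffD2])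
    then show "l w \<in> Lf" "nbrs A (l w) = {w}" using uniq nbrs_sym by (metis IntD1 IntD2)+
  qed
  define U where "U = iso \<union> K2 \<union> l ` cen"
  have "inj_on l cen" using l(2) by (intro inj_onI) (metis singleton_inject)
  then have cl: "card (l ` cen) = card cen" by (rule card_image)
  have "iso \<inter> K2 = {}" "(iso \<union> K2) \<inter> l ` cen = {}"
  proof -
    show "iso \<inter> K2 = {}" by (auto simp: iso_def K2_def K_def Lf_def)
    have "l w \<notin> iso" "l w \<notin> K2" if "w \<in> cen" for w
      using l[OF that] that by (auto simp: iso_def K2_def K_def Lf_def cen_def G_def)
    then show "(iso \<union> K2) \<inter> l ` cen = {}" by auto
  qed
  then have cU: "card U = card iso + card K2 + card cen"
    unfolding U_def using fins cl by (simp add: card_Un_disjoint)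
  have "card (nbrs A u) = 1" if "u \<in> Lf" for u using single[OF that] by auto
  then have "card Lf = (\<Sum>u\<in>Lf. card (nbrs A u))" by simp
  also have "\<dots> = (\<Sum>u\<in>Lf. \<Sum>w\<in>V. if w \<in> nbrs A u then 1 else 0)"
  proof (rule sum.cong[OF refl])
    fix u
    have "nbrs A u = {w \<in> V. w \<in> nbrs A u}" using nV by auto
    then show "card (nbrs A u) = (\<Sum>w\<in>V. if w \<in> nbrs A u then 1 else 0)"
      using assms(1) by (subst card_eq_sum) (simp add: sum.If_cases Int_def)
  qed
  also have "\<dots> = (\<Sum>w\<in>V. \<Sum>u\<in>Lf. if w \<in> nbrs A u then 1 else 0)" by (rule sum.swap)
  also have "\<dots> = (\<Sum>w\<in>V. lf w)"
  proof (rule sum.cong[OF refl])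
    fix w
    have "nbrs A w \<inter> Lf = {u \<in> Lf. w \<in> nbrs A u}" using nbrs_sym[of _ A w] by blast
    then show "(\<Sum>u\<in>Lf. if w \<in> nbrs A u then 1 else 0) = lf w"
      unfolding lf_def using fins(1) by (subst card_eq_sum) (simp add: sum.If_cases Int_def)
  qed
  finally have cLf: "card Lf = (\<Sum>w\<in>V. lf w)" .
  have split: "(\<Sum>v\<in>V. f v) = (\<Sum>v\<in>iso. f v) + (\<Sum>v\<in>Lf. f v) + (\<Sum>v\<in>G. f v)" for f :: "'a \<Rightarrow> int"
  proof -
    have "V = iso \<union> Lf \<union> G" by (auto simp: iso_def Lf_def G_def)
    moreover have "iso \<inter> Lf = {}" "(iso \<union> Lf) \<inter> G = {}" by (auto simp: iso_def Lf_def G_def)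
    ultimately show ?thesis using fins by (metis (no_types, lifting) finite_Un sum.union_disjoint)
  qed
  have "lf v = 0" if "v \<in> iso" for v
    using lfd[of v] that by (simp add: iso_def)
  then have s1: "(\<Sum>v\<in>iso. int (lf v)) = 0" by simp
  have "lf v = (if v \<in> K then 1 else 0)" if v: "v \<in> Lf" for v
  proof -
    obtain w where "nbrs A v = {w}" using single[OF v] by auto
    then show ?thesis using v by (auto simp: lf_def K_def)
  qed
  then have "(\<Sum>v\<in>Lf. lf v) = (\<Sum>v\<in>Lf. if v \<in> K then 1 else 0)" by (intro sum.cong) auto
  also have "\<dots> = card (Lf \<inter> K)" using fins by (simp add: sum.If_cases)
  also have "Lf \<inter> K = K" by (auto simp: K_def)
  finally have s2: "(\<Sum>v\<in>Lf. int (lf v)) = int (card K)" by (metis of_nat_sum)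
  have "card K \<le> card (K2 \<union> (\<lambda>u. the_elem (nbrs A u)) ` K2)"
  proof (intro card_mono)
    show "K \<subseteq> K2 \<union> (\<lambda>u. the_elem (nbrs A u)) ` K2"
    proof
      fix v assume v: "v \<in> K"
      then have vL: "v \<in> Lf" by (simp add: K_def)
      obtain w where w: "nbrs A v = {w}" "w \<noteq> v" using single[OF vL] by auto
      then have wL: "w \<in> Lf" using v by (auto simp: K_def)
      have wv: "nbrs A w = {v}" using uniq[OF wL] w nbrs_sym by (metis singletonI)
      show "v \<in> K2 \<union> (\<lambda>u. the_elem (nbrs A u)) ` K2"
      proof (cases "v < w")
        case True then show ?thesis using v w by (simp add: K2_def)
      next
        case False
        then have "w \<in> K2" using w wv wL vL by (auto simp: K2_def K_def)
        then show ?thesis using wv by (intro UnI2 image_eqI[of _ _ w]) auto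
      qed
    qed
  qed (use fins in auto)
  also have "\<dots> \<le> card K2 + card K2"
    using card_Un_le card_image_le[OF fins(4)] by (meson add_left_mono order_trans)
  finally have cK: "card K \<le> 2 * card K2" by simp
  have "(\<Sum>v\<in>G. 2 - int (d v) + int (lf v)) \<le> (\<Sum>v\<in>G. if v \<in> cen then 2 else 0)"
  proof (rule sum_mono)
    fix v assume "v \<in> G"
    then show "2 - int (d v) + int (lf v) \<le> (if v \<in> cen then 2 else 0)"
      using lfd[of v] by (auto simp: cen_def)
  qed
  also have "\<dots> = 2 * int (card (G \<inter> cen))" using fins by (simp add: sum.If_cases)
  also have "G \<inter> cen = cen" by (auto simp: cen_def)
  finally have s3: "(\<Sum>v\<in>G. 2 - int (d v)) + (\<Sum>v\<in>G. int (lf v)) \<le> 2 * int (card cen)"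
    by (simp add: sum.distrib)
  have "int (\<Sum>v\<in>V. d v) \<le> 2 * int (card A)"
    using sum_arc_deg_le[OF assms(1) finA] unfolding d_def by linarith
  then have "(\<Sum>v\<in>V. int (d v)) \<le> 2 * int (card A)" by simp
  then have "2 * int (card V) - 2 * int (card A) \<le> (\<Sum>v\<in>V. 2 - int (d v))"
    by (simp add: sum_subtractf)
  also have "\<dots> = (\<Sum>v\<in>iso. 2 - int (d v)) + (\<Sum>v\<in>Lf. 2 - int (d v)) + (\<Sum>v\<in>G. 2 - int (d v))"
    by (rule split)
  also have "(\<Sum>v\<in>iso. 2 - int (d v)) = 2 * int (card iso)" by (simp add: iso_def)
  also have "(\<Sum>v\<in>Lf. 2 - int (d v)) = int (card Lf)" by (simp add: Lf_def)
  also have "int (card Lf) = (\<Sum>v\<in>V. int (lf v))" using cLf by simp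
  also have "\<dots> = int (card K) + (\<Sum>v\<in>G. int (lf v))" using split[of "\<lambda>v. int (lf v)"] s1 s2 by simp
  finally have "card V \<le> card U + card A" using s3 cK cU by linarith
  moreover have "U \<subseteq> V"
    using l(1) by (auto simp: U_def iso_def K2_def K_def Lf_def)
  moreover have dU: "\<forall>u\<in>U. d u \<le> 1"
    using l(1) by (auto simp: U_def iso_def K2_def K_def Lf_def)
  moreover have isoN: "nbrs A u = {}" if "u \<in> iso" for u
    using nbrs_arc_deg_0[OF finA] that by (auto simp: iso_def d_def)
  have UN: "u \<in> Lf \<and> nbrs A u = {w} \<and> (w \<in> cen \<and> u = l w \<or> u \<in> K2 \<and> w \<in> Lf \<and> nbrs A w = {u} \<and> u < w)"
    if u: "u \<in> U" and w: "w \<in> nbrs A u" for u w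
  proof -
    have "u \<in> K2 \<or> u \<in> l ` cen" using u w isoN by (auto simp: U_def)
    then show ?thesis
    proof
      assume uK: "u \<in> K2"
      then have "u \<in> Lf" "u < w" "nbrs A u \<inter> Lf \<noteq> {}" using w by (auto simp: K2_def K_def)
      moreover then have "nbrs A u = {w}" using uniq w by auto
      moreover then have "w \<in> Lf" using calculation by auto
      moreover then have "nbrs A w = {u}" using uniq w nbrs_sym by metis
      ultimately show ?thesis using uK by auto
    next
      assume "u \<in> l ` cen"
      then show ?thesis using l w by auto
    qed
  qed
  moreover have "\<forall>u\<in>U. nbrs A u \<inter> U = {}"
  proof (intro ballI equals0I)
    fix u w assume u: "u \<in> U" and w: "w \<in> nbrs A u \<inter> U"
    have "u \<in> nbrs A w" using w nbrs_sym by (metis IntD1)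
    then show False using UN[of u w] UN[of w u] u w by (auto simp: cen_def G_def Lf_def)
  qed
  moreover have "\<forall>u\<in>U. \<forall>v\<in>U. u \<noteq> v \<longrightarrow> nbrs A u \<inter> nbrs A v = {}"
  proof (intro ballI impI equals0I)
    fix u v w assume uv: "u \<in> U" "v \<in> U" "u \<noteq> v" and w: "w \<in> nbrs A u \<inter> nbrs A v"
    then show False using UN[of u w] UN[of v w] by (auto simp: cen_def G_def Lf_def)
  qed
  moreover have "\<forall>u\<in>U. \<forall>w\<in>nbrs A u. card {v \<in> nbrs A w. d v \<noteq> 1} \<le> 1"
  proof (intro ballI)
    fix u w assume u: "u \<in> U" and w: "w \<in> nbrs A u"
    consider "w \<in> cen" | "nbrs A w = {u}" using UN[OF u w] by auto
    then show "card {v \<in> nbrs A w. d v \<noteq> 1} \<le> 1"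
    proof cases
      case 1
      have "nbrs A w = {v \<in> nbrs A w. d v \<noteq> 1} \<union> (nbrs A w \<inter> Lf)" using nV by (auto simp: Lf_def)
      moreover have "{v \<in> nbrs A w. d v \<noteq> 1} \<inter> (nbrs A w \<inter> Lf) = {}" by (auto simp: Lf_def)
      ultimately have "card (nbrs A w) = card {v \<in> nbrs A w. d v \<noteq> 1} + lf w"
        unfolding lf_def using finite_nbrs[OF finA, of w] by (metis (no_types, lifting) card_Un_disjoint finite_Un)
      then show ?thesis using nd[of w] 1 by (simp add: cen_def)
    next
      case 2
      then have "{v \<in> nbrs A w. d v \<noteq> 1} \<subseteq> {u}" by auto
      then show ?thesis using card_mono[of "{u}"] by fastforce
    qed
  qed
  ultimately show ?thesis unfolding d_def by blast
qed

section \<open>Completing a partial placement\<close>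

text \<open>
  The placed set \<open>L\<close> forbids some images to the unplaced vertices. By \<open>press\<close> at most \<open>card J\<close>
  targets are forbidden for more than \<open>P\<close> vertices; these targets are covered by \<open>J\<close>, and the
  remaining vertices are handled by the exchange argument.
\<close>

lemma complete_placing:
  assumes fin: "finite V1" "finite V2" "finite A" "finite A'" and cV: "card V1 = card V2"
    and irr: "irrefl A" "irrefl A'"
    and LJ: "L \<subseteq> V1" "J \<subseteq> V1" "L \<inter> J = {}"
    and f: "placed A A' V2 L f"
    and low: "\<And>w. w \<in> L \<Longrightarrow> card (nbrs A' (f w)) \<le> T"
    and J: "\<And>u. u \<in> J \<Longrightarrow> nbrs A u \<subseteq> L" "\<And>u. u \<in> J \<Longrightarrow> card (nbrs A u) \<le> 1"
    and half: "\<And>s. s \<in> V2 \<Longrightarrow> 2 * card {u \<in> J. \<exists>w\<in>nbrs A u. s \<in> nbrs A' (f w)} \<le> card J"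
    and rest: "\<And>v. v \<in> V1 - L - J \<Longrightarrow> card (nbrs A v) \<le> d"
    and t: "\<And>s. s \<in> V2 \<Longrightarrow> card (nbrs A' s) \<le> t"
    and press: "T * (\<Sum>w\<in>L. card (nbrs A w)) < (card J + 1) * (P + 1)"
    and cJ: "2 * T < card J"
    and big: "card L + card J + d * T + P + 2 * d * t + d < card V1"
  shows "\<exists>h. bij_betw h V1 V2 \<and> (\<forall>w\<in>L. h w = f w) \<and>
    (\<forall>u\<in>V1. \<forall>v\<in>V1. v \<in> nbrs A u \<longrightarrow> h v \<notin> nbrs A' (h u))"
proof -
  have finL: "finite L" "finite J" using LJ fin finite_subset by blast+
  have finN: "finite (nbrs A v)" "finite (nbrs A' s)" for v s
    using fin by (simp_all add: finite_nbrs)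
  have injf: "inj_on f L" and fL: "f ` L \<subseteq> V2"
    and fconf: "\<And>u v. u \<in> L \<Longrightarrow> v \<in> L \<Longrightarrow> v \<in> nbrs A u \<Longrightarrow> f v \<notin> nbrs A' (f u)"
    using f by (auto simp: placed_def)
  define Q where "Q = V2 - f ` L"
  define R where "R = V1 - L - J"
  define F where "F v = (\<Union>w\<in>nbrs A v \<inter> L. nbrs A' (f w))" for v
  define forb where "forb s = {v \<in> R. s \<in> F v}" for s
  define Ov where "Ov = {s \<in> Q. P < card (forb s)}"
  have finQ: "finite Q" "finite R" "finite Ov" using fin by (auto simp: Q_def R_def Ov_def)
  have finforb: "finite (forb s)" for s using finQ by (simp add: forb_def)
  have finF: "finite (F v)" for v unfolding F_def using finN finL by auto
  have cQ: "card Q = card V2 - card L"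
    unfolding Q_def using fL finL card_image[OF injf] by (simp add: card_Diff_subset)
  have cL: "card L \<le> card V1" using LJ fin card_mono by blast
  have "card Ov * (P + 1) \<le> (\<Sum>s\<in>Q. card (forb s))"
    by (rule card_mult_le_sum) (use finQ in \<open>auto simp: Ov_def\<close>)
  also have "\<dots> = card (SIGMA s:Q. forb s)" using finQ finforb by simp
  also have "\<dots> \<le> card (\<Union>w\<in>L. nbrs A' (f w) \<times> nbrs A w)"
  proof (rule card_mono)
    show "(SIGMA s:Q. forb s) \<subseteq> (\<Union>w\<in>L. nbrs A' (f w) \<times> nbrs A w)"
      by (auto simp: forb_def F_def) (metis nbrs_sym)
  qed (use finL finN in auto)
  also have "\<dots> \<le> (\<Sum>w\<in>L. card (nbrs A' (f w) \<times> nbrs A w))" by (rule card_UN_le[OF finL(1)])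
  also have "\<dots> \<le> (\<Sum>w\<in>L. T * card (nbrs A w))"
    using low by (intro sum_mono) (simp add: card_cartesian_product)
  also have "\<dots> = T * (\<Sum>w\<in>L. card (nbrs A w))" by (simp add: sum_distrib_left)
  finally have "card Ov * (P + 1) < (card J + 1) * (P + 1)" using press by linarith
  then have "card Ov < card J + 1" by (rule mult_less_cancel2[THEN iffD1, THEN conjunct2])
  then have cOv: "card Ov \<le> card J" by simp
  have "card J - card Ov \<le> card (Q - Ov)"
    using cQ cV big finQ card_Diff_subset[of Ov Q] by (auto simp: Ov_def)
  then obtain S where S: "S \<subseteq> Q - Ov" "card S = card J - card Ov"
    using obtain_subset_with_card_n by metis
  define Op where "Op = Ov \<union> S"
  have "card Op = card Ov + card S"
    unfolding Op_def using S finQ finite_subset[of S] by (intro card_Un_disjoint) auto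
  then have cOp: "card Op = card J" using S cOv by simp
  have OpQ: "Op \<subseteq> Q" using S by (auto simp: Op_def Ov_def)
  have FJ: "F u = (\<Union>w\<in>nbrs A u. nbrs A' (f w))" if "u \<in> J" for u
    using J(1)[OF that] unfolding F_def by (simp add: Int_absorb2)
  have "\<exists>g. bij_betw g J Op \<and> (\<forall>u\<in>J. g u \<notin> F u) \<and> (\<forall>u\<in>J. \<forall>v\<in>J. v \<in> {} \<longrightarrow> g v \<notin> {})"
  proof (rule swap_packing[where d = 0 and t = 0 and \<alpha> = T and \<beta> = "card J div 2"])
    show "finite J" "finite Op" using finL OpQ finQ finite_subset by auto
    show "card (F u \<inter> Op) \<le> T" if "u \<in> J" for u
    proof -
      have "card (F u \<inter> Op) \<le> card (F u)" using finF by (intro card_mono) auto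
      also have "\<dots> \<le> (\<Sum>w\<in>nbrs A u. card (nbrs A' (f w)))"
        unfolding FJ[OF that] by (rule card_UN_le[OF finN(1)])
      also have "\<dots> \<le> (\<Sum>w\<in>nbrs A u. T)" using J(1)[OF that] low by (intro sum_mono) auto
      also have "\<dots> \<le> 1 * T" using J(2)[OF that] by simp
      finally show ?thesis by simp
    qed
    show "card {u \<in> J. b \<in> F u} \<le> card J div 2" if "b \<in> Op" for b
    proof -
      have "{u \<in> J. b \<in> F u} = {u \<in> J. \<exists>w\<in>nbrs A u. b \<in> nbrs A' (f w)}" using FJ by auto
      then show ?thesis using half[of b] that OpQ by (auto simp: Q_def)
    qed
    show "T + card J div 2 + 2 * 0 * 0 + 0 < card J" using cJ by linarith
  qed (use cOp in auto)
  then obtain g1 where g1: "bij_betw g1 J Op" "\<And>u. u \<in> J \<Longrightarrow> g1 u \<notin> F u" by blast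
  have cR: "card R = card V1 - card L - card J"
  proof -
    have "J \<subseteq> V1 - L" using LJ by auto
    then show ?thesis unfolding R_def using LJ finL by (simp add: card_Diff_subset)
  qed
  have cR': "card R = card (Q - Op)"
    using cR cQ cV cOp OpQ finQ finite_subset[of Op Q] by (simp add: card_Diff_subset)
  have "\<exists>g. bij_betw g R (Q - Op) \<and> (\<forall>u\<in>R. g u \<notin> F u) \<and>
      (\<forall>u\<in>R. \<forall>v\<in>R. v \<in> nbrs A u \<longrightarrow> g v \<notin> nbrs A' (g u))"
  proof (rule swap_packing[where d = d and t = t and \<alpha> = "d * T" and \<beta> = P])
    show "v \<in> nbrs A u \<longleftrightarrow> u \<in> nbrs A v" for u v by (rule nbrs_sym)
    show "v \<in> nbrs A' u \<longleftrightarrow> u \<in> nbrs A' v" for u v by (rule nbrs_sym)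
    show "u \<notin> nbrs A u" for u by (rule nbrs_irrefl[OF irr(1)])
    show "u \<notin> nbrs A' u" for u by (rule nbrs_irrefl[OF irr(2)])
    show "card (nbrs A u \<inter> R) \<le> d" if "u \<in> R" for u
      using rest[of u] that card_mono[OF finN(1), of "nbrs A u \<inter> R" u] by (auto simp: R_def)
    show "card (nbrs A' b \<inter> (Q - Op)) \<le> t" if "b \<in> Q - Op" for b
      using t[of b] that card_mono[OF finN(2), of "nbrs A' b \<inter> (Q - Op)" b] by (auto simp: Q_def)
    show "card (F u \<inter> (Q - Op)) \<le> d * T" if "u \<in> R" for u
    proof -
      have "card (F u \<inter> (Q - Op)) \<le> card (F u)" using finF by (intro card_mono) auto
      also have "\<dots> \<le> (\<Sum>w\<in>nbrs A u \<inter> L. card (nbrs A' (f w)))"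
        unfolding F_def using finL by (intro card_UN_le) auto
      also have "\<dots> \<le> (\<Sum>w\<in>nbrs A u \<inter> L. T)" using low by (intro sum_mono) auto
      also have "\<dots> = card (nbrs A u \<inter> L) * T" by simp
      also have "\<dots> \<le> d * T"
        using rest[of u] that card_mono[OF finN(1), of "nbrs A u \<inter> L" u]
        by (intro mult_le_mono1) (auto simp: R_def)
      finally show ?thesis .
    qed
    show "card {u \<in> R. b \<in> F u} \<le> P" if "b \<in> Q - Op" for b
      using that by (auto simp: Op_def Ov_def forb_def)
    show "d * T + P + 2 * d * t + d < card R" using big cR by linarith
  qed (use finQ cR' in auto)
  then obtain g2 where g2: "bij_betw g2 R (Q - Op)" "\<And>u. u \<in> R \<Longrightarrow> g2 u \<notin> F u"
    "\<And>u v. u \<in> R \<Longrightarrow> v \<in> R \<Longrightarrow> v \<in> nbrs A u \<Longrightarrow> g2 v \<notin> nbrs A' (g2 u)" by blast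
  define h where "h v = (if v \<in> L then f v else if v \<in> J then g1 v else g2 v)" for v
  have hL: "h v = f v" if "v \<in> L" for v using that by (simp add: h_def)
  have hJ: "h v = g1 v" if "v \<in> J" for v using that LJ(3) by (auto simp: h_def)
  have hR: "h v = g2 v" if "v \<in> R" for v using that by (auto simp: h_def R_def)
  have b1: "bij_betw h L (f ` L)"
    using injf hL by (simp add: bij_betw_def inj_on_def)
  have b2: "bij_betw h J Op" using g1(1) hJ by (simp cong: bij_betw_cong)
  have b3: "bij_betw h R (Q - Op)" using g2(1) hR by (simp cong: bij_betw_cong)
  have "bij_betw h (L \<union> J) (f ` L \<union> Op)"
    by (rule bij_betw_combine[OF b1 b2]) (use OpQ in \<open>auto simp: Q_def\<close>)
  then have "bij_betw h (L \<union> J \<union> R) (f ` L \<union> Op \<union> (Q - Op))"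
    by (rule bij_betw_combine[OF _ b3]) (auto simp: Q_def)
  moreover have "L \<union> J \<union> R = V1" using LJ by (auto simp: R_def)
  moreover have "f ` L \<union> Op \<union> (Q - Op) = V2" using fL OpQ by (auto simp: Q_def)
  ultimately have bij: "bij_betw h V1 V2" by simp
  have outF: "h u \<notin> F u" if "u \<in> J \<union> R" for u using that g1(2) g2(2) hJ hR by auto
  have key: "h v \<notin> nbrs A' (h u)" if "u \<in> V1" "v \<in> L" "v \<in> nbrs A u" for u v
  proof (cases "u \<in> L")
    case True then show ?thesis using that fconf hL by auto
  next
    case False
    then have "h u \<notin> F u" using outF that by (auto simp: R_def)
    then have "h u \<notin> nbrs A' (f v)" using that by (auto simp: F_def)
    then show ?thesis using hL[OF that(2)] nbrs_sym by metis
  qed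
  have "h v \<notin> nbrs A' (h u)" if uv: "u \<in> V1" "v \<in> V1" "v \<in> nbrs A u" for u v
  proof -
    have vu: "u \<in> nbrs A v" using uv nbrs_sym by metis
    consider "v \<in> L" | "u \<in> L" | "u \<in> R" "v \<in> R"
      using J(1) uv vu by (auto simp: R_def)
    then show ?thesis
    proof cases
      case 1 then show ?thesis using key uv by auto
    next
      case 2 then show ?thesis using key[of v u] uv vu nbrs_sym by metis
    next
      case 3 then show ?thesis using g2(3)[OF 3 uv(3)] hR by auto
    qed
  qed
  then show ?thesis using bij hL by blast
qed

section \<open>Giant vertices\<close>

lemma nbrs_converse: "nbrs (A\<inverse>) = nbrs A"
  by (auto simp: nbrs_def fun_eq_iff)

lemma arc_deg_converse: "arc_deg (A\<inverse>) = arc_deg A"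
proof
  fix v
  have "{e \<in> A\<inverse>. fst e = v \<or> snd e = v} = {e \<in> A. fst e = v \<or> snd e = v}\<inverse>" by auto
  then show "arc_deg (A\<inverse>) v = arc_deg A v" by (simp add: arc_deg_def card_inverse)
qed

lemma restr_converse: "restr (A\<inverse>) S = (restr A S)\<inverse>"
  by (auto simp: restr_def)

lemma restr_converse_empty: "restr (A\<inverse>) S = {} \<longleftrightarrow> restr A S = {}"
  by (auto simp: restr_def)

definition out_free :: "('a \<times> 'a) set \<Rightarrow> 'a set \<Rightarrow> 'a \<Rightarrow> 'a set" where
  "out_free A V x = {y \<in> V. y \<noteq> x \<and> (x, y) \<notin> A}"

definition compat :: "('a \<times> 'a) set \<Rightarrow> ('b \<times> 'b) set \<Rightarrow> 'a \<Rightarrow> 'b \<Rightarrow> 'a \<Rightarrow> 'b \<Rightarrow> bool" where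
  "compat A A' z x p y \<longleftrightarrow> ((z, p) \<in> A \<longrightarrow> (x, y) \<notin> A') \<and> ((p, z) \<in> A \<longrightarrow> (y, x) \<notin> A')"

lemma compat_converse: "compat (A\<inverse>) (A'\<inverse>) = compat A A'"
  by (auto simp: compat_def fun_eq_iff)

lemma finite_out_free: "finite V \<Longrightarrow> finite (out_free A V x)"
  by (simp add: out_free_def)

lemma card_out_free:
  assumes "finite V" "A \<subseteq> V \<times> V" "irrefl A" "x \<in> V"
  shows "card (out_free A V x) + card {e \<in> A. fst e = x} = card V - 1"
proof -
  have "{e \<in> A. fst e = x} = Pair x ` {y \<in> V. (x, y) \<in> A}" using assms(2) by auto
  then have "card {e \<in> A. fst e = x} = card {y \<in> V. (x, y) \<in> A}"
    by (simp add: card_image inj_on_def)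
  moreover have "V - {x} = out_free A V x \<union> {y \<in> V. (x, y) \<in> A}"
    using assms(3) by (auto simp: out_free_def irrefl_def)
  moreover have "out_free A V x \<inter> {y \<in> V. (x, y) \<in> A} = {}" by (auto simp: out_free_def)
  ultimately have "card (V - {x}) = card (out_free A V x) + card {e \<in> A. fst e = x}"
    using assms(1) finite_out_free[OF assms(1)] by (simp add: card_Un_disjoint)
  then show ?thesis using assms(1,4) by simp
qed

lemma card_in_arcs_converse: "card {e \<in> A\<inverse>. fst e = x} = card {e \<in> A. snd e = x}"
proof -
  have "{e \<in> A\<inverse>. fst e = x} = {e \<in> A. snd e = x}\<inverse>" by auto
  then show ?thesis by (simp add: card_inverse)
qed

lemma arc_deg_out_in:
  assumes "finite A" "irrefl A"
  shows "arc_deg A x = card {e \<in> A. fst e = x} + card {e \<in> A. snd e = x}"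
proof -
  have "{e \<in> A. fst e = x \<or> snd e = x} = {e \<in> A. fst e = x} \<union> {e \<in> A. snd e = x}" by auto
  moreover have "{e \<in> A. fst e = x} \<inter> {e \<in> A. snd e = x} = {}" using assms(2) by (auto simp: irrefl_def)
  ultimately show ?thesis unfolding arc_deg_def using assms(1) by (simp add: card_Un_disjoint)
qed

lemma arc_deg_free:
  assumes "finite V" "A \<subseteq> V \<times> V" "irrefl A" "x \<in> V"
  shows "card (out_free A V x) + card (out_free (A\<inverse>) V x) + arc_deg A x = 2 * (card V - 1)"
proof -
  have "finite A" using assms finite_subset by blast
  moreover have "A\<inverse> \<subseteq> V \<times> V" "irrefl (A\<inverse>)" using assms by (auto simp: irrefl_def)
  ultimately show ?thesis
    using card_out_free[OF assms] card_out_free[OF assms(1) _ _ assms(4), of "A\<inverse>"]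
      arc_deg_out_in[OF _ assms(3)] card_in_arcs_converse[of A x] by simp
qed

lemma arc_deg_le_restr:
  assumes "finite A" "A \<subseteq> V \<times> V" "finite X" "y \<notin> X"
  shows "arc_deg A y \<le> arc_deg (restr A (V - X)) y + 2 * card X"
proof -
  have "{e \<in> A. fst e = y \<or> snd e = y} \<subseteq> {e \<in> restr A (V - X). fst e = y \<or> snd e = y}
      \<union> Pair y ` X \<union> (\<lambda>x. (x, y)) ` X" (is "_ \<subseteq> ?R \<union> ?P \<union> ?S")
    using assms by (auto simp: restr_def)
  moreover have "finite (?R \<union> ?P \<union> ?S)" using assms by (simp add: finite_restr)
  ultimately have "arc_deg A y \<le> card (?R \<union> ?P \<union> ?S)"
    unfolding arc_deg_def by (rule card_mono[rotated])
  also have "\<dots> \<le> card ?R + card ?P + card ?S"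
    using card_Un_le[of "?R \<union> ?P" ?S] card_Un_le[of ?R ?P] by linarith
  also have "\<dots> \<le> card ?R + card X + card X"
    using card_image_le[OF assms(3)] by (meson add_le_mono order_refl)
  finally show ?thesis by (simp add: arc_deg_def)
qed

lemma card_restr_add_nbrs:
  assumes "finite A" "A \<subseteq> V \<times> V"
  shows "card (restr A (V - Z)) + card ((\<Union>z\<in>Z. nbrs A z) - Z) \<le> card A"
proof -
  have "(\<Union>z\<in>Z. nbrs A z) - Z \<subseteq> (\<lambda>e. if fst e \<in> Z then snd e else fst e) ` (A - restr A (V - Z))"
  proof
    fix p assume "p \<in> (\<Union>z\<in>Z. nbrs A z) - Z"
    then obtain z where z: "z \<in> Z" "p \<notin> Z" "(z, p) \<in> A \<or> (p, z) \<in> A" by (auto simp: nbrs_def)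
    then show "p \<in> (\<lambda>e. if fst e \<in> Z then snd e else fst e) ` (A - restr A (V - Z))"
    proof (elim disjE)
      assume "(z, p) \<in> A"
      then show ?thesis using z by (intro image_eqI[of _ _ "(z, p)"]) (auto simp: restr_def)
    next
      assume "(p, z) \<in> A"
      then show ?thesis using z by (intro image_eqI[of _ _ "(p, z)"]) (auto simp: restr_def)
    qed
  qed
  then have "card ((\<Union>z\<in>Z. nbrs A z) - Z) \<le> card (A - restr A (V - Z))"
    by (rule surj_card_le[rotated]) (use assms in simp)
  also have "\<dots> = card A - card (restr A (V - Z))"
    using assms by (intro card_Diff_subset) (auto simp: restr_def)
  finally show ?thesis
    using card_mono[OF assms(1) restr_subset(1), of "V - Z"] by linarith
qed

lemma light_sink:
  assumes "finite V" "A \<subseteq> V \<times> V" "irrefl A" "Z \<subseteq> V" "card A + k \<le> card V" "card Z < k"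
  shows "\<exists>z\<in>V - Z - (\<Union>z\<in>Z. nbrs A z). (\<forall>w. (z, w) \<notin> A) \<and> (k - card Z) * arc_deg A z \<le> card A"
proof -
  have finA: "finite A" using assms finite_subset by blast
  have finZ: "finite Z" using assms finite_subset by blast
  define N where "N = (\<Union>z\<in>Z. nbrs A z)"
  define B where "B = restr A (V - Z)"
  define Q where "Q = V - Z - (N - Z) - fst ` B"
  have NV: "N \<subseteq> V" using nbrs_subset[OF assms(2)] by (auto simp: N_def)
  have finB: "finite B" using finA by (simp add: B_def finite_restr)
  have finQ: "finite Q" using assms(1) by (simp add: Q_def)
  have "card V - card Z = card (V - Z)" using finZ assms by (simp add: card_Diff_subset)
  also have "\<dots> \<le> card (Q \<union> (N - Z) \<union> fst ` B)"
    using finB finQ NV assms(1) finite_subset by (intro card_mono) (auto simp: Q_def)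
  also have "\<dots> \<le> card Q + card (N - Z) + card (fst ` B)"
    using card_Un_le[of "Q \<union> (N - Z)" "fst ` B"] card_Un_le[of Q "N - Z"] by linarith
  also have "\<dots> \<le> card Q + card A"
    using card_image_le[OF finB, of fst] card_restr_add_nbrs[OF finA assms(2), of Z]
    by (simp add: N_def B_def)
  finally have cQ: "k - card Z \<le> card Q" using assms(5) by linarith
  have sink: "(z, w) \<notin> A" if "z \<in> Q" for z w
  proof
    assume zw: "(z, w) \<in> A"
    have "w \<notin> Z"
    proof
      assume "w \<in> Z"
      then have "z \<in> N" using zw by (auto simp: N_def nbrs_def)
      then show False using that by (auto simp: Q_def)
    qed
    then have "(z, w) \<in> B" using zw that assms(2) by (auto simp: B_def restr_def Q_def)
    then have "z \<in> fst ` B" by force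
    then show False using that by (auto simp: Q_def)
  qed
  have "(\<Sum>z\<in>Q. arc_deg A z) = (\<Sum>z\<in>Q. card {e \<in> A. snd e = z})"
  proof (rule sum.cong[OF refl])
    fix z assume "z \<in> Q"
    then have "{e \<in> A. fst e = z} = {}" using sink by auto
    then have "card {e \<in> A. fst e = z} = 0" by (metis card.empty)
    then show "arc_deg A z = card {e \<in> A. snd e = z}"
      using arc_deg_out_in[OF finA assms(3), of z] by linarith
  qed
  also have "\<dots> = card (\<Union>z\<in>Q. {e \<in> A. snd e = z})"
    using finQ finA by (intro card_UN_disjoint[symmetric]) auto
  also have "\<dots> \<le> card A" using finA by (intro card_mono) auto
  finally have sum: "(\<Sum>z\<in>Q. arc_deg A z) \<le> card A" .
  have "\<exists>z\<in>Q. (k - card Z) * arc_deg A z \<le> card A"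
  proof (rule ccontr)
    assume "\<not> ?thesis"
    then have "card Q * (card A + 1) \<le> (\<Sum>z\<in>Q. (k - card Z) * arc_deg A z)"
      using finQ by (intro card_mult_le_sum) (auto simp: not_le)
    also have "\<dots> = (k - card Z) * (\<Sum>z\<in>Q. arc_deg A z)" by (simp add: sum_distrib_left)
    also have "\<dots> \<le> card Q * card A" using cQ sum by (intro mult_le_mono)
    finally have "card Q = 0" by simp
    then show False using cQ assms(6) by simp
  qed
  then show ?thesis using sink unfolding Q_def N_def by blast
qed

locale digraph_pair =
  fixes V :: "'a::linorder set" and V' :: "'b set" and A A' and n m :: nat
  assumes fin: "finite V" "finite V'" and card_V: "card V = n" "card V' = n"
    and arcs: "A \<subseteq> V \<times> V" "A' \<subseteq> V' \<times> V'" and irr: "irrefl A" "irrefl A'"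
    and m: "93 \<le> m" and n: "31 * m \<le> n"
    and card_A: "card A + m \<le> n" and card_A': "card A' + n div m + 1 \<le> 2 * n"
begin

lemma finA: "finite A" "finite A'"
  using fin arcs finite_subset by blast+

lemma converse: "digraph_pair V V' (A\<inverse>) (A'\<inverse>) n m"
  using fin card_V arcs irr m n card_A card_A'
  by unfold_locales (auto simp: irrefl_def card_inverse)

lemma n_ge: "2883 \<le> n"
  using m n by linarith

lemma q_ge: "31 \<le> n div m"
proof -
  have "31 * m div m \<le> n div m" using n by (rule div_le_mono)
  then show ?thesis using m by simp
qed

lemma card_A'_le: "card A' + 32 \<le> 2 * n"
  using card_A' q_ge by linarith

text \<open>
  With \<open>a \<le> b\<close> missing out-arcs and in-arcs at \<open>x\<close>, at most \<open>a + b + 1 - q\<close> arcs of \<open>A'\<close> avoid \<open>x\<close>.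
  If some missing out-neighbour of \<open>x\<close> has low degree, a vertex of \<open>A\<close> of degree at most 1 can go to \<open>x\<close>.
  Otherwise these \<open>a\<close> vertices already account for so many arcs that the \<open>b\<close> missing in-neighbours
  contain \<open>q - 1\<close> independent ones of low degree, enough for the in-neighbours of the lightest sink.
\<close>

lemma place_giant_aux:
  assumes x: "x \<in> V'" and le: "card (out_free A' V' x) \<le> card (out_free (A'\<inverse>) V' x)"
  shows "\<exists>z\<in>V. \<exists>g. m * card (nbrs A z) \<le> n \<and> inj_on g (nbrs A z) \<and> g ` nbrs A z \<subseteq> V' - {x} \<and>
    restr A' (g ` nbrs A z) = {} \<and>
    (\<forall>p\<in>nbrs A z. arc_deg (restr A' (V' - {x})) (g p) \<le> 9 \<and> compat A A' z x p (g p))"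
proof -
  define a b where "a = card (out_free A' V' x)" and "b = card (out_free (A'\<inverse>) V' x)"
  define D where "D = restr A' (V' - {x})"
  define q where "q = n div m"
  have finD: "finite D" using finA by (simp add: D_def finite_restr)
  have "card D + arc_deg A' x = card A'"
    unfolding D_def by (rule card_restr_delete[OF arcs(2) finA(2)])
  moreover have "a + b + arc_deg A' x = 2 * (n - 1)"
    using arc_deg_free[OF fin(2) arcs(2) irr(2) x] card_V by (simp add: a_def b_def)
  ultimately have D: "card D + q \<le> a + b + 1"
    using card_A' n_ge unfolding q_def by linarith
  have q: "31 \<le> q" using q_ge by (simp add: q_def)
  have irrs: "restr A' {y} = {}" for y using irr(2) by (auto simp: restr_def irrefl_def)
  show ?thesis
  proof (cases "\<exists>y\<in>out_free A' V' x. arc_deg D y \<le> 9")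
    case True
    then obtain y1 where y1: "y1 \<in> out_free A' V' x" "arc_deg D y1 \<le> 9" by auto
    then have "a > 0" using finite_out_free[OF fin(2)] by (auto simp: a_def card_gt_0_iff)
    have "\<exists>y\<in>out_free (A'\<inverse>) V' x. arc_deg D y \<le> 9"
    proof (rule ccontr)
      assume "\<not> ?thesis"
      then have "b * 10 \<le> (\<Sum>y\<in>out_free (A'\<inverse>) V' x. arc_deg D y)"
        unfolding b_def using finite_out_free[OF fin(2)] by (intro card_mult_le_sum) (auto simp: not_le)
      also have "\<dots> \<le> 2 * card D" using finD finite_out_free[OF fin(2)] by (intro sum_arc_deg_le)
      finally show False using D q le \<open>a > 0\<close> by (simp add: a_def b_def)
    qed
    then obtain y2 where y2: "y2 \<in> out_free (A'\<inverse>) V' x" "arc_deg D y2 \<le> 9" by auto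
    have "\<exists>z\<in>V. arc_deg A z \<le> 1"
    proof (rule ccontr)
      assume "\<not> ?thesis"
      then have "card V * 2 \<le> (\<Sum>z\<in>V. arc_deg A z)"
        using fin by (intro card_mult_le_sum) (auto simp: not_le)
      then show False using sum_arc_deg_le[OF fin(1) finA(1)] card_A card_V m by linarith
    qed
    then obtain z where z: "z \<in> V" "arc_deg A z \<le> 1" by auto
    show ?thesis
    proof (cases "arc_deg A z = 0")
      case True
      then show ?thesis using z nbrs_arc_deg_0[OF finA(1)]
        by (intro bexI[of _ z] exI[of _ "\<lambda>_. y1"]) (auto simp: restr_def)
    next
      case False
      then have z1: "arc_deg A z = 1" using z by simp
      obtain w where w: "nbrs A z = {w}" "w \<noteq> z" using nbrs_arc_deg_1[OF irr(1) finA(1) z1] by auto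
      have not2: "\<not> ((z, w) \<in> A \<and> (w, z) \<in> A)"
      proof
        assume "(z, w) \<in> A \<and> (w, z) \<in> A"
        then have "{(z, w), (w, z)} \<subseteq> {e \<in> A. fst e = z \<or> snd e = z}" by auto
        then have "card {(z, w), (w, z)} \<le> arc_deg A z"
          unfolding arc_deg_def using finA by (intro card_mono) auto
        then show False using z1 w(2) by simp
      qed
      define y where "y = (if (z, w) \<in> A then y1 else y2)"
      have "compat A A' z x w y"
        using y1 y2 not2 by (auto simp: y_def compat_def out_free_def)
      moreover have "y \<in> V' - {x}" "arc_deg D y \<le> 9"
        using y1 y2 by (auto simp: y_def out_free_def)
      moreover have "m * 1 \<le> n" using n by simp
      ultimately show ?thesis using z(1) w irrs unfolding D_def
        by (intro bexI[of _ z] exI[of _ "\<lambda>_. y"]) auto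
    qed
  next
    case False
    obtain Y where Y: "Y \<subseteq> out_free (A'\<inverse>) V' x" "restr D Y = {}" "\<forall>y\<in>Y. arc_deg D y \<le> 9"
      "b + card {v. 9 < arc_deg D v} \<le> card Y + card D"
      using independent_subset[OF finD finite_out_free[OF fin(2)], of 9 "A'\<inverse>" x]
      unfolding b_def by auto
    have "finite {v. 9 < arc_deg D v}"
    proof (rule finite_subset[of _ V'])
      show "{v. 9 < arc_deg D v} \<subseteq> V'"
      proof
        fix v assume "v \<in> {v. 9 < arc_deg D v}"
        then have "{e \<in> D. fst e = v \<or> snd e = v} \<noteq> {}" unfolding arc_deg_def by fastforce
        then show "v \<in> V'" using arcs by (auto simp: D_def restr_def)
      qed
    qed (rule fin)
    then have "a \<le> card {v. 9 < arc_deg D v}"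
      unfolding a_def using False by (intro card_mono) (auto simp: not_le)
    then have cY: "q \<le> card Y + 1" using Y(4) D by linarith
    obtain z where z: "z \<in> V" "\<And>w. (z, w) \<notin> A" "m * arc_deg A z \<le> card A"
      using light_sink[OF fin(1) arcs(1) irr(1), of "{}" m] card_A card_V m by auto
    have mz: "m * card (nbrs A z) \<le> card A"
      using z(3) card_nbrs_le[OF finA(1), of z] by (meson mult_le_mono2 order_trans)
    then have "m * (card (nbrs A z) + 1) \<le> n" using card_A by (simp add: algebra_simps)
    then have "card (nbrs A z) + 1 \<le> q"
      unfolding q_def using m by (simp add: less_eq_div_iff_mult_less_eq mult.commute)
    then have "card (nbrs A z) \<le> card Y" using cY by linarith
    moreover have finY: "finite Y" using Y(1) finite_out_free[OF fin(2)] finite_subset by blast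
    ultimately obtain g where g: "inj_on g (nbrs A z)" "g ` nbrs A z \<subseteq> Y"
      using card_le_inj[OF finite_nbrs[OF finA(1)]] by blast
    have Yx: "Y \<subseteq> V' - {x}" using Y(1) by (auto simp: out_free_def)
    have "restr A' (g ` nbrs A z) \<subseteq> restr D Y" using g(2) Yx by (auto simp: restr_def D_def)
    moreover have "compat A A' z x p (g p)" if "p \<in> nbrs A z" for p
      using that g(2) Y(1) z(2) by (auto simp: compat_def out_free_def)
    moreover have "m * card (nbrs A z) \<le> n" using mz card_A by linarith
    ultimately show ?thesis using z(1) g Y(2,3) Yx unfolding D_def
      by (intro bexI[of _ z] exI[of _ g]) auto
  qed
qed

lemma place_giant:
  assumes x: "x \<in> V'"
  shows "\<exists>z\<in>V. \<exists>g. m * card (nbrs A z) \<le> n \<and> inj_on g (nbrs A z) \<and> g ` nbrs A z \<subseteq> V' - {x} \<and>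
    restr A' (g ` nbrs A z) = {} \<and>
    (\<forall>p\<in>nbrs A z. arc_deg (restr A' (V' - {x})) (g p) \<le> 9 \<and> compat A A' z x p (g p))"
proof (cases "card (out_free A' V' x) \<le> card (out_free (A'\<inverse>) V' x)")
  case True
  then show ?thesis using place_giant_aux[OF x] by simp
next
  case False
  interpret R: digraph_pair V V' "A\<inverse>" "A'\<inverse>" n m by (rule converse)
  have le: "card (out_free (A'\<inverse>) V' x) \<le> card (out_free ((A'\<inverse>)\<inverse>) V' x)" using False by simp
  show ?thesis using R.place_giant_aux[OF x le]
    by (simp only: nbrs_converse restr_converse_empty compat_converse)
      (simp only: restr_converse arc_deg_converse)
qed

definition giant :: "'b \<Rightarrow> bool" where
  "giant x \<longleftrightarrow> 3 * card (out_free A' V' x) < n \<or> 3 * card (out_free (A'\<inverse>) V' x) < n"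

lemma giant_half_aux:
  assumes x: "x \<in> V'" "3 * card (out_free A' V' x) < n" and Z: "Z \<subseteq> V" "card Z \<le> 1"
  shows "\<exists>z\<in>V - Z - (\<Union>z\<in>Z. nbrs A z). 92 * card (nbrs A z) \<le> n \<and>
    (\<exists>C\<subseteq>V' - {x}. (\<forall>y\<in>C. \<forall>p. compat A A' z x p y) \<and> 5 * (n - 1) \<le> 3 * arc_deg A' x + 3 * card C)"
proof -
  obtain z where z: "z \<in> V - Z - (\<Union>z\<in>Z. nbrs A z)" "\<And>w. (z, w) \<notin> A"
    "(m - card Z) * arc_deg A z \<le> card A"
    using light_sink[OF fin(1) arcs(1) irr(1) Z(1), of m] card_A card_V m Z(2) by auto
  have "92 * card (nbrs A z) \<le> (m - card Z) * arc_deg A z"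
    using card_nbrs_le[OF finA(1), of z] m Z(2) by (intro mult_le_mono) auto
  then have "92 * card (nbrs A z) \<le> n" using z(3) card_A by linarith
  moreover have "\<forall>y\<in>out_free (A'\<inverse>) V' x. \<forall>p. compat A A' z x p y"
    using z(2) by (auto simp: compat_def out_free_def)
  moreover have "5 * (n - 1) \<le> 3 * arc_deg A' x + 3 * card (out_free (A'\<inverse>) V' x)"
    using arc_deg_free[OF fin(2) arcs(2) irr(2) x(1)] x(2) unfolding card_V by presburger
  moreover have "out_free (A'\<inverse>) V' x \<subseteq> V' - {x}" by (auto simp: out_free_def)
  ultimately show ?thesis using z(1) by blast
qed

lemma giant_half:
  assumes x: "x \<in> V'" "giant x" and Z: "Z \<subseteq> V" "card Z \<le> 1"
  shows "\<exists>z\<in>V - Z - (\<Union>z\<in>Z. nbrs A z). 92 * card (nbrs A z) \<le> n \<and>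
    (\<exists>C\<subseteq>V' - {x}. (\<forall>y\<in>C. \<forall>p. compat A A' z x p y) \<and> 5 * (n - 1) \<le> 3 * arc_deg A' x + 3 * card C)"
proof (cases "3 * card (out_free A' V' x) < n")
  case True
  then show ?thesis using giant_half_aux[OF x(1) _ Z] by simp
next
  case False
  interpret R: digraph_pair V V' "A\<inverse>" "A'\<inverse>" n m by (rule converse)
  have "3 * card (out_free (A'\<inverse>) V' x) < n" using False x(2) by (simp add: giant_def)
  then show ?thesis using R.giant_half_aux[OF x(1) _ Z]
    by (simp add: nbrs_converse arc_deg_converse compat_converse)
qed

lemma arc_deg_giant:
  assumes "x \<in> V'" "giant x" shows "2 * (n - 1) \<le> 3 * arc_deg A' x"
proof -
  have "card (out_free B V' x) \<le> n - 1" for B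
  proof -
    have "card (out_free B V' x) \<le> card (V' - {x})"
      using fin by (intro card_mono) (auto simp: out_free_def)
    then show ?thesis using fin assms(1) card_V by simp
  qed
  from this[of A'] this[of "A'\<inverse>"] show ?thesis
    using arc_deg_free[OF fin(2) arcs(2) irr(2) assms(1)] card_V assms(2) unfolding giant_def by linarith
qed

text \<open>
  All giants lie in \<open>X\<close> and are taken by \<open>Z\<close> via \<open>\<phi>\<close>; \<open>g\<close> places the neighbours of \<open>Z\<close>.
\<close>

definition prepared :: "'a set \<Rightarrow> 'b set \<Rightarrow> ('a \<Rightarrow> 'b) \<Rightarrow> ('a \<Rightarrow> 'b) \<Rightarrow> bool" where
  "prepared Z X \<phi> g \<longleftrightarrow> (let P = (\<Union>z\<in>Z. nbrs A z) in
    Z \<subseteq> V \<and> X \<subseteq> V' \<and> bij_betw \<phi> Z X \<and> card Z \<le> 2 \<and> Z \<inter> P = {} \<and>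
    inj_on g P \<and> g ` P \<subseteq> V' - X \<and> restr A' (g ` P) = {} \<and>
    (\<forall>p\<in>P. arc_deg (restr A' (V' - X)) (g p) \<le> 9) \<and>
    (\<forall>z\<in>Z. \<forall>p\<in>nbrs A z. compat A A' z (\<phi> z) p (g p)) \<and>
    92 * card P \<le> card Z * n \<and>
    3 * card (restr A' (V' - X)) + 2 * card X * (n - 1) + 90 \<le> 6 * n \<and>
    (\<forall>x\<in>V' - X. \<not> giant x))"

lemma prepared_exists: "\<exists>Z X \<phi> g. prepared Z X \<phi> g"
proof (cases "\<exists>x1\<in>V'. \<exists>x2\<in>V'. x1 \<noteq> x2 \<and> giant x1 \<and> giant x2")
  case True
  then obtain x1 x2 where x: "x1 \<in> V'" "x2 \<in> V'" "x1 \<noteq> x2" "giant x1" "giant x2" by auto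
  obtain z1 C1 where z1: "z1 \<in> V" "92 * card (nbrs A z1) \<le> n" "C1 \<subseteq> V' - {x1}"
    "\<forall>y\<in>C1. \<forall>p. compat A A' z1 x1 p y" "5 * (n - 1) \<le> 3 * arc_deg A' x1 + 3 * card C1"
    using giant_half[OF x(1,4), of "{}"] by auto
  obtain z2 C2 where z2: "z2 \<in> V - {z1} - nbrs A z1" "92 * card (nbrs A z2) \<le> n" "C2 \<subseteq> V' - {x2}"
    "\<forall>y\<in>C2. \<forall>p. compat A A' z2 x2 p y" "5 * (n - 1) \<le> 3 * arc_deg A' x2 + 3 * card C2"
    using giant_half[OF x(2,5), of "{z1}"] z1(1) by auto
  define P where "P = nbrs A z1 \<union> nbrs A z2"
  define X where "X = {x1, x2}"
  define D where "D = restr A' (V' - X)"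
  have finD: "finite D" using finA by (simp add: D_def finite_restr)
  have finC: "finite C1" "finite C2" using z1(3) z2(3) fin finite_subset by blast+
  have D2: "D = restr (restr A' (V' - {x1})) (V' - {x1} - {x2})"
    by (auto simp: D_def X_def restr_def)
  have cD: "card D + arc_deg (restr A' (V' - {x1})) x2 = card (restr A' (V' - {x1}))"
    unfolding D2 by (rule card_restr_delete[OF restr_subset(2) finite_restr[OF finA(2)]])
  have cD1: "card (restr A' (V' - {x1})) + arc_deg A' x1 = card A'"
    by (rule card_restr_delete[OF arcs(2) finA(2)])
  have d2: "arc_deg A' x2 \<le> arc_deg (restr A' (V' - {x1})) x2 + 2"
    using arc_deg_le_restr[OF finA(2) arcs(2), of "{x1}" x2] x(3) by simp
  have "card (C1 \<union> C2) \<le> n"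
    using card_mono[OF fin(2), of "C1 \<union> C2"] z1(3) z2(3) card_V by auto
  then have cC: "card C1 + card C2 \<le> card (C1 \<inter> C2) + n"
    using card_Un_Int[OF finC] by linarith
  obtain Y where Y: "Y \<subseteq> C1 \<inter> C2" "restr D Y = {}" "\<forall>y\<in>Y. arc_deg D y \<le> 9"
    "card (C1 \<inter> C2) + card {v. 9 < arc_deg D v} \<le> card Y + card D"
    using independent_subset[OF finD, of "C1 \<inter> C2" 9] finC by auto
  have cP: "card P \<le> card (nbrs A z1) + card (nbrs A z2)" unfolding P_def by (rule card_Un_le)
  define k where "k = n - 1"
  have nk: "n = k + 1" using n_ge by (simp add: k_def)
  have "card P \<le> card Y"
    using cP z1(2) z1(5)[folded k_def] z2(2) z2(5)[folded k_def] cC cD cD1 d2 Y(4) card_A'_le nk n_ge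
    by linarith
  moreover have "finite Y" using Y(1) finC finite_subset by blast
  moreover have "finite P" using finA by (simp add: P_def finite_nbrs)
  ultimately obtain g where g: "inj_on g P" "g ` P \<subseteq> Y" using card_le_inj by blast
  have YX: "Y \<subseteq> V' - X" using Y(1) z1(3) z2(3) by (auto simp: X_def)
  have "restr A' (g ` P) \<subseteq> restr D Y" using g(2) YX by (auto simp: restr_def D_def)
  then have r0: "restr A' (g ` P) = {}" using Y(2) by simp
  have low: "\<forall>p\<in>P. arc_deg D (g p) \<le> 9" using g(2) Y(3) by auto
  define \<phi> where "\<phi> z = (if z = z1 then x1 else x2)" for z
  have ne: "z2 \<noteq> z1" using z2 by auto
  have bij: "bij_betw \<phi> {z1, z2} X"
    using ne x(3) by (auto simp: bij_betw_def inj_on_def \<phi>_def X_def)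
  have comp: "\<forall>z\<in>{z1, z2}. \<forall>p\<in>nbrs A z. compat A A' z (\<phi> z) p (g p)"
    using z1(4) z2(4) g(2) Y(1) ne by (auto simp: \<phi>_def P_def image_subset_iff)
  have c2: "card {z1, z2} = 2" "card X = 2" using ne x(3) by (auto simp: X_def)
  have bound: "3 * card D + 2 * 2 * (n - 1) + 90 \<le> 6 * n"
    using cD cD1 d2 arc_deg_giant[OF x(1,4)] arc_deg_giant[OF x(2,5)] card_A'_le n_ge by linarith
  have nog: "\<not> giant y" if y: "y \<in> V' - X" for y
  proof
    assume "giant y"
    then have "2 * (n - 1) \<le> 3 * arc_deg A' y" using arc_deg_giant y by auto
    moreover have "arc_deg A' y \<le> arc_deg D y + 2 * card X"
      unfolding D_def using y by (intro arc_deg_le_restr[OF finA(2) arcs(2)]) (auto simp: X_def)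
    moreover have "arc_deg D y \<le> card D"
      unfolding arc_deg_def using finD by (intro card_mono) auto
    ultimately show False using bound c2 n_ge by linarith
  qed
  have PZ: "(\<Union>z\<in>{z1, z2}. nbrs A z) = P" by (auto simp: P_def)
  have dis: "{z1, z2} \<inter> P = {}"
    using z2(1) nbrs_irrefl[OF irr(1)] nbrs_sym[of z1 A z2] by (auto simp: P_def)
  have "prepared {z1, z2} X \<phi> g"
    unfolding prepared_def PZ Let_def
    using z1(1) z2(1) x bij c2 dis g YX r0 low comp bound nog cP z1(2) z2(2)
    by (auto simp: D_def X_def)
  then show ?thesis by blast
next
  case False
  show ?thesis
  proof (cases "\<exists>x\<in>V'. giant x")
    case True
    then obtain x where x: "x \<in> V'" "giant x" by auto
    then have nog: "\<not> giant y" if "y \<in> V' - {x}" for y using False that by auto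
    obtain z g where zg: "z \<in> V" "m * card (nbrs A z) \<le> n" "inj_on g (nbrs A z)"
      "g ` nbrs A z \<subseteq> V' - {x}" "restr A' (g ` nbrs A z) = {}"
      "\<forall>p\<in>nbrs A z. arc_deg (restr A' (V' - {x})) (g p) \<le> 9 \<and> compat A A' z x p (g p)"
      using place_giant[OF x(1)] by blast
    have "93 * card (nbrs A z) \<le> n" using zg(2) m by (meson mult_le_mono1 order_trans)
    moreover have "3 * card (restr A' (V' - {x})) + 2 * 1 * (n - 1) + 90 \<le> 6 * n"
      using card_restr_delete[OF arcs(2) finA(2), of x] arc_deg_giant[OF x] card_A'_le n_ge by linarith
    moreover have "bij_betw (\<lambda>_. x) {z} {x}" by (auto simp: bij_betw_def)
    ultimately have "prepared {z} {x} (\<lambda>_. x) g"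
      unfolding prepared_def Let_def using zg x nog nbrs_irrefl[OF irr(1)] by auto
    then show ?thesis by blast
  next
    case no: False
    have "restr A' V' = A'" using arcs by (auto simp: restr_def)
    moreover have "3 * card A' + 90 \<le> 6 * n" using card_A'_le by linarith
    ultimately have "prepared {} {} undefined undefined"
      unfolding prepared_def Let_def using no by (auto simp: bij_betw_def restr_def)
    then show ?thesis by blast
  qed
qed

end

section \<open>Existence of a packing\<close>

lemma combine_packing:
  assumes "A \<subseteq> V \<times> V" "Z \<subseteq> V" "X \<subseteq> V'"
    and \<phi>: "bij_betw \<phi> Z X" and h: "bij_betw h (V - Z) (V' - X)"
    and indep: "Z \<inter> (\<Union>z\<in>Z. nbrs A z) = {}"
    and comp: "\<And>z p. z \<in> Z \<Longrightarrow> p \<in> nbrs A z \<Longrightarrow> compat A A' z (\<phi> z) p (h p)"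
    and hconf: "\<And>u v. u \<in> V - Z \<Longrightarrow> v \<in> V - Z \<Longrightarrow> v \<in> nbrs A u \<Longrightarrow> h v \<notin> nbrs (restr A' (V' - X)) (h u)"
  shows "\<exists>H. bij_betw H V V' \<and> (\<forall>u v. (u, v) \<in> A \<longrightarrow> (H u, H v) \<notin> A')"
proof -
  define H where "H v = (if v \<in> Z then \<phi> v else h v)" for v
  have "bij_betw H Z X" using \<phi> by (simp add: H_def cong: bij_betw_cong)
  moreover have "bij_betw H (V - Z) (V' - X)" 
    by (rule bij_betw_cong[THEN iffD2, OF _ h]) (simp add: H_def)
  ultimately have "bij_betw H (Z \<union> (V - Z)) (X \<union> (V' - X))" by (rule bij_betw_combine) auto
  moreover have "Z \<union> (V - Z) = V" "X \<union> (V' - X) = V'" using assms by auto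
  ultimately have bij: "bij_betw H V V'" by simp
  have "(H u, H v) \<notin> A'" if uv: "(u, v) \<in> A" for u v
  proof -
    have V: "u \<in> V" "v \<in> V" and nb: "v \<in> nbrs A u" "u \<in> nbrs A v" using uv assms(1) by (auto simp: nbrs_def)
    consider "u \<in> Z" "v \<notin> Z" | "u \<notin> Z" "v \<in> Z" | "u \<notin> Z" "v \<notin> Z" using indep nb by blast
    then show ?thesis
    proof cases
      case 1
      then show ?thesis using comp[OF 1(1) nb(1)] uv by (simp add: compat_def H_def)
    next
      case 2
      then show ?thesis using comp[OF 2(2) nb(2)] uv by (simp add: compat_def H_def)
    next
      case 3
      have "h u \<in> V' - X" "h v \<in> V' - X" using h V 3 by (auto simp: bij_betw_def)
      moreover have "h v \<notin> nbrs (restr A' (V' - X)) (h u)" using hconf nb V 3 by auto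
      ultimately show ?thesis using 3 by (auto simp: H_def nbrs_def restr_def)
    qed
  qed
  then show ?thesis using bij by blast
qed

lemma card_low:
  assumes "finite V" "finite A"
  shows "(T + 1) * card V \<le> (T + 1) * card {v \<in> V. arc_deg A v \<le> T} + 2 * card A"
proof -
  have "V = {v \<in> V. arc_deg A v \<le> T} \<union> {v \<in> V. T < arc_deg A v}" by auto
  then have "card V \<le> card {v \<in> V. arc_deg A v \<le> T} + card {v \<in> V. T < arc_deg A v}"
    by (metis card_Un_le)
  then have "(T + 1) * card V \<le> (T + 1) * (card {v \<in> V. arc_deg A v \<le> T} + card {v \<in> V. T < arc_deg A v})"
    by (rule mult_le_mono2)
  then show ?thesis using card_high[OF assms, of T] by (simp add: algebra_simps)
qed

context digraph_pair
begin

lemma pack_many_isolated: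
  assumes I: "I \<subseteq> V" "187 \<le> card I" "\<And>v. v \<in> I \<Longrightarrow> arc_deg A v = 0"
  shows "\<exists>H. bij_betw H V V' \<and> (\<forall>u v. (u, v) \<in> A \<longrightarrow> (H u, H v) \<notin> A')"
proof -
  have NI: "nbrs A v = {}" if "v \<in> I" for v using nbrs_arc_deg_0[OF finA(1)] I(3) that by auto
  define t where "t = n div 50"
  have t: "n < 50 * t + 50" "50 * t \<le> n" by (auto simp: t_def)
  obtain X where X: "X \<subseteq> V'" "card X * (t + 1) \<le> card A'"
    "\<forall>v\<in>V' - X. arc_deg (restr A' (V' - X)) v \<le> t"
    using peel[OF fin(2) arcs(2), of t] by blast
  have cX: "card X \<le> 99"
  proof (rule ccontr)
    assume "\<not> ?thesis"
    then have "100 * (t + 1) \<le> card X * (t + 1)" by (intro mult_le_mono1) simp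
    then have "100 * t + 100 \<le> card X * (t + 1)" by simp
    then show False using X(2) card_A'_le t by linarith
  qed
  obtain Z where Z: "Z \<subseteq> I" "card Z = card X"
    using obtain_subset_with_card_n[of "card X" I] cX I(2) by auto
  have fins: "finite I" "finite Z" "finite X"
    using I(1) Z(1) X(1) fin by (meson finite_subset)+
  have "80 \<le> card (I - Z)" using Z cX I(2) fins by (simp add: card_Diff_subset)
  then obtain J where J: "J \<subseteq> I - Z" "card J = 80" using obtain_subset_with_card_n by metis
  obtain \<phi> where \<phi>: "bij_betw \<phi> Z X" using finite_same_card_bij[OF fins(2,3) Z(2)] by blast
  define V2 where "V2 = V' - X"
  define A2 where "A2 = restr A' V2"
  define Low where "Low = {s \<in> V2. arc_deg A2 s \<le> 9}"
  have finA2: "finite A2" using finA by (simp add: A2_def finite_restr)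
  have irr2: "irrefl A2" using irr by (simp add: A2_def irrefl_restr)
  have finV2: "finite V2" "finite Low" using fin by (auto simp: V2_def Low_def)
  have cV2: "card V2 = n - card X" using X(1) fins card_V by (simp add: V2_def card_Diff_subset)
  have "card A2 \<le> card A'" unfolding A2_def using finA by (intro card_mono restr_subset) auto
  moreover have "10 * card V2 \<le> 10 * card Low + 2 * card A2"
    using card_low[OF finV2(1) finA2, of 9] by (simp add: Low_def)
  ultimately have cLow: "6 * n \<le> 10 * card Low + 990"
    using cV2 cX card_A'_le n_ge by linarith
  have lowN: "card (nbrs A2 y) \<le> 9" if "y \<in> Low" for y
    using that card_nbrs_le[OF finA2, of y] by (simp add: Low_def)
  have cA: "card A \<le> n" using card_A by linarith
  define S1 where "S1 = {v \<in> V. 40 < arc_deg A v}"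
  define S2 where "S2 = {v \<in> V. 4 < arc_deg A v} - S1"
  have finS: "finite S1" "finite S2" using fin by (auto simp: S1_def S2_def)
  have SS: "S1 \<union> S2 = {v \<in> V. 4 < arc_deg A v}" by (auto simp: S1_def S2_def)
  have c1: "card S1 * 41 \<le> 2 * n" using card_high[OF fin(1) finA(1), of 40] cA by (simp add: S1_def)
  have c2: "card (S1 \<union> S2) * 5 \<le> 2 * n" using card_high[OF fin(1) finA(1), of 4] cA by (simp add: SS)
  have "placed A A2 Low {} undefined" by (auto simp: placed_def)
  then have "\<exists>g. placed A A2 Low ({} \<union> S1) g \<and> (\<forall>v\<in>{}. g v = undefined v) \<and> (\<forall>v\<in>S1. g v \<in> Low)"
  proof (rule placed_extend[OF finS(1) _ _ _ finV2(2) finA2 irr(1) lowN])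
    fix v
    have "card (nbrs A v \<inter> ({} \<union> S1)) \<le> card S1" using finS by (intro card_mono) auto
    then show "card ({} \<union> S1) + 9 * card (nbrs A v \<inter> ({} \<union> S1)) \<le> card Low"
      using c1 cLow n_ge by simp
  qed auto
  then obtain f1 where f1: "placed A A2 Low S1 f1" by auto
  have "\<exists>g. placed A A2 Low (S1 \<union> S2) g \<and> (\<forall>v\<in>S1. g v = f1 v) \<and> (\<forall>v\<in>S2. g v \<in> Low)"
  proof (rule placed_extend[OF finS(2) f1 finS(1) _ finV2(2) finA2 irr(1) lowN])
    fix v assume "v \<in> S2"
    then have "card (nbrs A v) \<le> 40"
      using card_nbrs_le[OF finA(1), of v] by (auto simp: S1_def S2_def)
    then have "card (nbrs A v \<inter> (S1 \<union> S2)) \<le> 40"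
      using card_mono[OF finite_nbrs[OF finA(1)], of "nbrs A v \<inter> (S1 \<union> S2)" v] by auto
    then show "card (S1 \<union> S2) + 9 * card (nbrs A v \<inter> (S1 \<union> S2)) \<le> card Low"
      using c2 cLow n_ge by linarith
  qed (auto simp: S2_def)
  then obtain f where f: "placed A A2 Low (S1 \<union> S2) f" by auto
  then have f': "placed A A2 V2 (S1 \<union> S2) f" by (auto simp: placed_def Low_def)
  have "\<exists>h. bij_betw h (V - Z) V2 \<and> (\<forall>w\<in>S1 \<union> S2. h w = f w) \<and>
    (\<forall>u\<in>V - Z. \<forall>v\<in>V - Z. v \<in> nbrs A u \<longrightarrow> h v \<notin> nbrs A2 (h u))"
  proof (rule complete_placing[where T = 9 and J = J and d = 4 and t = t and P = "n div 4"])
    show "card (V - Z) = card V2" using Z I(1) fins card_V cV2 by (simp add: card_Diff_subset)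
    show "S1 \<union> S2 \<subseteq> V - Z" "J \<subseteq> V - Z" "(S1 \<union> S2) \<inter> J = {}"
      using Z(1) J(1) I unfolding SS by auto
    show "card (nbrs A2 (f w)) \<le> 9" if "w \<in> S1 \<union> S2" for w
      using that f lowN by (auto simp: placed_def)
    show "nbrs A u \<subseteq> S1 \<union> S2" "card (nbrs A u) \<le> 1" if "u \<in> J" for u
      using that NI J(1) by auto
    show "2 * card {u \<in> J. \<exists>w\<in>nbrs A u. s \<in> nbrs A2 (f w)} \<le> card J" for s
    proof -
      have "{u \<in> J. \<exists>w\<in>nbrs A u. s \<in> nbrs A2 (f w)} = {}" using NI J(1) by auto
      then show ?thesis by (simp only: card.empty)
    qed
    show "card (nbrs A v) \<le> 4" if "v \<in> V - Z - (S1 \<union> S2) - J" for v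
      using that card_nbrs_le[OF finA(1), of v] unfolding SS by auto
    show "card (nbrs A2 s) \<le> t" if "s \<in> V2" for s
      using that X(3) card_nbrs_le[OF finA2, of s] unfolding A2_def V2_def by (meson order_trans)
    have "(\<Sum>w\<in>S1 \<union> S2. card (nbrs A w)) \<le> (\<Sum>w\<in>S1 \<union> S2. arc_deg A w)"
      using card_nbrs_le[OF finA(1)] by (intro sum_mono)
    also have "\<dots> \<le> 2 * card A" using finS finA by (intro sum_arc_deg_le) auto
    finally show "9 * (\<Sum>w\<in>S1 \<union> S2. card (nbrs A w)) < (card J + 1) * (n div 4 + 1)"
      using cA J(2) by simp
    have "n div 4 * 4 \<le> n" by simp
    moreover have "card (V - Z) = n - card X" using Z I(1) fins card_V by (simp add: card_Diff_subset)
    ultimately show "card (S1 \<union> S2) + card J + 4 * 9 + n div 4 + 2 * 4 * t + 4 < card (V - Z)"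
      using c2 J(2) t(2) cX n_ge by linarith
  qed (use fin finV2 finA finA2 irr irr2 f' J in auto)
  then obtain h where h: "bij_betw h (V - Z) V2"
    "\<And>u v. u \<in> V - Z \<Longrightarrow> v \<in> V - Z \<Longrightarrow> v \<in> nbrs A u \<Longrightarrow> h v \<notin> nbrs A2 (h u)" by blast
  show ?thesis
  proof (rule combine_packing[OF arcs(1) _ X(1) \<phi> h(1)[unfolded V2_def]])
    show "Z \<subseteq> V" using Z(1) I(1) by auto
    show "Z \<inter> (\<Union>z\<in>Z. nbrs A z) = {}" using NI Z(1) by auto
    show "compat A A' z (\<phi> z) p (h p)" if "z \<in> Z" "p \<in> nbrs A z" for z p using that NI Z(1) by auto
    show "h v \<notin> nbrs (restr A' (V' - X)) (h u)" if "u \<in> V - Z" "v \<in> V - Z" "v \<in> nbrs A u" for u v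
      using h(2)[OF that] by (simp add: A2_def V2_def)
  qed
qed

lemma sum_excess_degree:
  assumes "card {v \<in> V. arc_deg A v = 0} \<le> 186"
  shows "(\<Sum>v\<in>V. arc_deg A v - 1) \<le> n"
proof -
  have "(\<Sum>v\<in>V. arc_deg A v - 1) + card V = (\<Sum>v\<in>V. (arc_deg A v - 1) + 1)" by (simp only: sum.distrib card_eq_sum)
  also have "\<dots> = (\<Sum>v\<in>V. arc_deg A v + (if arc_deg A v = 0 then 1 else 0))"
    by (intro sum.cong) auto
  also have "\<dots> = (\<Sum>v\<in>V. arc_deg A v) + card {v \<in> V. arc_deg A v = 0}"
    using fin by (simp add: sum.distrib sum.If_cases Int_def)
  finally show ?thesis using sum_arc_deg_le[OF fin(1) finA(1)] card_A m assms card_V by linarith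
qed



lemma fresh_units:
  assumes prep: "prepared Z X \<phi> g"
  defines "P \<equiv> \<Union>z\<in>Z. nbrs A z"
  shows "\<exists>U\<subseteq>V - Z. 93 \<le> card U + card Z \<and>
    (\<forall>u\<in>U. u \<notin> P \<and> nbrs A u \<subseteq> V - Z - P - U \<and> arc_deg A u \<le> 1) \<and>
    (\<forall>u\<in>U. \<forall>v\<in>U. u \<noteq> v \<longrightarrow> nbrs A u \<inter> nbrs A v = {}) \<and>
    (\<forall>u\<in>U. \<forall>w\<in>nbrs A u. card (nbrs A w \<inter> (P \<union> (\<Union>u\<in>U. nbrs A u))) \<le> card P + 1)"
proof -
  have Z: "Z \<subseteq> V" "Z \<inter> P = {}" using prep by (auto simp: prepared_def Let_def P_def)
  have PV: "P \<subseteq> V" using nbrs_subset[OF arcs(1)] by (auto simp: P_def)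
  have finP: "finite P" "finite Z" using PV Z fin by (meson finite_subset)+
  define B where "B = restr A (V - Z)"
  have B: "B \<subseteq> (V - Z) \<times> (V - Z)" "finite B" "irrefl B"
    unfolding B_def using restr_subset(2) finite_restr[OF finA(1)] irrefl_restr[OF irr(1)] by auto
  obtain U where U: "U \<subseteq> V - Z" "card (V - Z) \<le> card U + card B" "\<forall>u\<in>U. arc_deg B u \<le> 1"
    "\<forall>u\<in>U. nbrs B u \<inter> U = {}" "\<forall>u\<in>U. \<forall>v\<in>U. u \<noteq> v \<longrightarrow> nbrs B u \<inter> nbrs B v = {}"
    "\<forall>u\<in>U. \<forall>w\<in>nbrs B u. card {v \<in> nbrs B w. arc_deg B v \<noteq> 1} \<le> 1"
    using pendant_units[OF _ B(1,3)] fin by auto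
  define U' where "U' = {u \<in> U. u \<notin> P \<and> nbrs B u \<inter> P = {}}"
  have finU: "finite U" using U(1) fin by (meson finite_Diff finite_subset)
  have "card (U - U') \<le> card P"
  proof -
    define k where "k u = (SOME p. p \<in> insert u (nbrs B u) \<inter> P)" for u
    have k: "k u \<in> insert u (nbrs B u) \<inter> P" if "u \<in> U - U'" for u
      unfolding k_def using that by (intro someI_ex[of "\<lambda>p. p \<in> insert u (nbrs B u) \<inter> P"]) (auto simp: U'_def)
    have "inj_on k (U - U')"
    proof (rule inj_onI, rule ccontr)
      fix u v assume uv: "u \<in> U - U'" "v \<in> U - U'" "k u = k v" "u \<noteq> v"
      then have "k u \<in> insert u (nbrs B u)" "k u \<in> insert v (nbrs B v)" using k by (metis IntD1)+
      moreover have "nbrs B u \<inter> nbrs B v = {}" "v \<notin> nbrs B u" "u \<notin> nbrs B v"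
        using U(4,5) uv by blast+
      ultimately show False using uv(4) by auto
    qed
    then show ?thesis using k finP by (intro card_inj_on_le[of k]) auto
  qed
  moreover have "card U = card U' + card (U - U')"
    using finU card_Diff_subset[of U' U] card_mono[of U U'] finite_subset[of U' U] by (auto simp: U'_def)
  moreover have "card B + card P \<le> card A"
    using card_restr_add_nbrs[OF finA(1) arcs(1), of Z] Z(2) unfolding B_def P_def
    by (simp add: Diff_triv Int_commute)
  moreover have "card (V - Z) = n - card Z" using Z finP card_V by (simp add: card_Diff_subset)
  ultimately have c: "93 \<le> card U' + card Z" using U(2) card_A m by linarith
  have full: "nbrs A u = nbrs B u" "arc_deg A u = arc_deg B u" if u: "u \<in> V - Z" "u \<notin> P" for u
  proof -
    have nz: "w \<notin> Z" if "w \<in> nbrs A u" for w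
    proof
      assume "w \<in> Z"
      then have "u \<in> P" using that nbrs_sym by (force simp: P_def)
      then show False using u by simp
    qed
    then show "nbrs A u = nbrs B u"
      using u nbrs_subset[OF arcs(1)] by (auto simp: B_def nbrs_restr)
    have "{e \<in> A. fst e = u \<or> snd e = u} = {e \<in> B. fst e = u \<or> snd e = u}"
      using nz u arcs(1) by (auto simp: B_def restr_def nbrs_def)
    then show "arc_deg A u = arc_deg B u" by (simp add: arc_deg_def)
  qed
  have U'V: "u \<in> V - Z \<and> u \<notin> P" if "u \<in> U'" for u using that U(1) by (auto simp: U'_def)
  have N: "nbrs A u = nbrs B u" if "u \<in> U'" for u using full U'V that by blast
  have WU: "w \<in> V - Z \<and> w \<notin> P" if "u \<in> U'" "w \<in> nbrs B u" for u w
    using that nbrs_subset[OF B(1)] by (auto simp: U'_def)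
  have "card (nbrs A w \<inter> (P \<union> (\<Union>u\<in>U'. nbrs A u))) \<le> card P + 1" if u: "u \<in> U'" "w \<in> nbrs A u" for u w
  proof -
    have wB: "w \<in> nbrs B u" using u N by auto
    then have Nw: "nbrs A w = nbrs B w" using full WU u by blast
    have sub: "nbrs A w \<inter> (\<Union>u\<in>U'. nbrs A u) \<subseteq> {v \<in> nbrs B w. arc_deg B v \<noteq> 1}"
    proof
      fix v assume "v \<in> nbrs A w \<inter> (\<Union>u\<in>U'. nbrs A u)"
      then obtain u2 where v: "v \<in> nbrs B w" "u2 \<in> U'" "v \<in> nbrs B u2" using Nw N by auto
      have "arc_deg B v \<noteq> 1"
      proof
        assume "arc_deg B v = 1"
        then obtain x where "nbrs B v = {x}" using nbrs_arc_deg_1[OF B(3,2)] by blast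
        moreover have "w \<in> nbrs B v" "u2 \<in> nbrs B v" using v nbrs_sym by metis+
        ultimately have "w = u2" by auto
        then have "w \<in> nbrs B u \<inter> U" using v wB by (auto simp: U'_def)
        then show False using U(4) u by (auto simp: U'_def)
      qed
      then show "v \<in> {v \<in> nbrs B w. arc_deg B v \<noteq> 1}" using v by simp
    qed
    have "nbrs A w \<inter> (P \<union> (\<Union>u\<in>U'. nbrs A u)) \<subseteq> P \<union> {v \<in> nbrs B w. arc_deg B v \<noteq> 1}"
      using sub by blast
    then have "card (nbrs A w \<inter> (P \<union> (\<Union>u\<in>U'. nbrs A u))) \<le> card (P \<union> {v \<in> nbrs B w. arc_deg B v \<noteq> 1})"
      using finP finite_nbrs[OF B(2)] by (intro card_mono) auto
    also have "\<dots> \<le> card P + card {v \<in> nbrs B w. arc_deg B v \<noteq> 1}" by (rule card_Un_le)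
    also have "\<dots> \<le> card P + 1" using U(6) u(1) wB by (auto simp: U'_def)
    finally show ?thesis .
  qed
  moreover have "U' \<subseteq> V - Z" using U(1) by (auto simp: U'_def)
  moreover have "u \<notin> P \<and> nbrs A u \<subseteq> V - Z - P - U' \<and> arc_deg A u \<le> 1" if "u \<in> U'" for u
  proof -
    have "nbrs B u \<inter> U' = {}" using U(4) that by (auto simp: U'_def)
    then have "nbrs A u \<subseteq> V - Z - P - U'" using WU[OF that] N[OF that] by blast
    moreover have "arc_deg A u = arc_deg B u" by (rule full(2)) (use U'V[OF that] in blast)+
    then have "arc_deg A u \<le> 1" using U(3) that by (simp add: U'_def)
    ultimately show ?thesis using U'V that by auto
  qed
  moreover have "\<forall>u\<in>U'. \<forall>v\<in>U'. u \<noteq> v \<longrightarrow> nbrs A u \<inter> nbrs A v = {}"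
    using U(5) N unfolding U'_def by (metis (no_types, lifting) mem_Collect_eq)
  ultimately show ?thesis using c by (intro exI[of _ U']) blast
qed

lemma not_giant_room:
  assumes x: "x \<in> V'" "\<not> giant x" "x \<notin> X" and X: "X \<subseteq> V'" and Y: "Y \<subseteq> V' - X" "x \<in> Y"
    and C: "C = out_free A' V' x \<or> C = out_free (A'\<inverse>) V' x"
  defines "V2 \<equiv> V' - X - Y"
  shows "14 * n \<le> 30 * card (C \<inter> {s \<in> V2. arc_deg (restr A' V2) s \<le> 9})
    + 30 * card X + 30 * card Y + 6 * card (restr A' (V' - X)) + 12 * card X + 6"
proof -
  define k where "k = n - 1"
  have nk: "n = k + 1" using n_ge by (simp add: k_def)
  define A2 where "A2 = restr A' V2"
  define D where "D = restr A' (V' - X)"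
  define Low where "Low = {s \<in> V2. arc_deg A2 s \<le> 9}"
  define c1 c2 where "c1 = card (out_free A' V' x)" and "c2 = card (out_free (A'\<inverse>) V' x)"
  have finD: "finite D" "finite A2" using finA by (auto simp: D_def A2_def finite_restr)
  have finX: "finite X" "finite Y" "finite V2" using X Y fin by (auto simp: V2_def intro: finite_subset)
  have tot: "c1 + c2 + arc_deg A' x = 2 * k"
    using arc_deg_free[OF fin(2) arcs(2) irr(2) x(1)] card_V by (simp add: c1_def c2_def k_def)
  have large: "n \<le> 3 * c1" "n \<le> 3 * c2" using x(2) by (auto simp: giant_def c1_def c2_def)
  have "card (out_free B V' x) \<le> k" for B
  proof -
    have "card (out_free B V' x) \<le> card (V' - {x})"
      using fin by (intro card_mono) (auto simp: out_free_def)
    then show ?thesis using fin x(1) card_V by (simp add: k_def)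
  qed
  then have small: "c1 \<le> k" "c2 \<le> k" by (auto simp: c1_def c2_def)
  have CV: "C \<subseteq> V'" using C by (auto simp: out_free_def)
  have finC: "finite C" using CV fin by (meson finite_subset)
  have cC: "card C = c1 \<or> card C = c2" using C by (auto simp: c1_def c2_def)
  have "card (restr D (V' - X - {x})) + arc_deg D x = card D"
    by (rule card_restr_delete) (use finD in \<open>auto simp: D_def restr_def\<close>)
  moreover have "card A2 \<le> card (restr D (V' - X - {x}))"
    using finD Y(2) by (intro card_mono) (auto simp: A2_def D_def V2_def restr_def)
  moreover have "arc_deg A' x \<le> arc_deg D x + 2 * card X"
    unfolding D_def by (rule arc_deg_le_restr[OF finA(2) arcs(2) finX(1) x(3)])
  ultimately have A2: "card A2 + arc_deg A' x \<le> card D + 2 * card X" by linarith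
  have "C \<subseteq> (C \<inter> Low) \<union> X \<union> Y \<union> {s \<in> V2. 9 < arc_deg A2 s}"
    using CV by (auto simp: Low_def V2_def)
  then have "card C \<le> card ((C \<inter> Low) \<union> X \<union> Y \<union> {s \<in> V2. 9 < arc_deg A2 s})"
    using finC finX by (intro card_mono) auto
  also have "\<dots> \<le> card (C \<inter> Low) + card X + card Y + card {s \<in> V2. 9 < arc_deg A2 s}"
    by (meson add_le_mono1 card_Un_le order_trans)
  finally have cC': "card C \<le> card (C \<inter> Low) + card X + card Y + card {s \<in> V2. 9 < arc_deg A2 s}" .
  have "card {s \<in> V2. 9 < arc_deg A2 s} * 10 \<le> 2 * card A2"
    using card_high[OF finX(3) finD(2), of 9] by simp
  then have "14 * n \<le> 30 * card (C \<inter> Low) + 30 * card X + 30 * card Y + 6 * card D + 12 * card X + 6"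
    using cC cC' A2 tot large small nk by (elim disjE) linarith+
  then show ?thesis by (simp add: Low_def A2_def D_def)
qed

lemma card_peeled:
  assumes "c * (n div 27 + 1) \<le> r" "3 * r + 2 * g * (n - 1) + 90 \<le> 6 * n" "g \<le> 2"
  shows "c + 18 * g \<le> 53"
proof (rule ccontr)
  assume "\<not> ?thesis"
  then have c: "54 \<le> c + 18 * g" by simp
  define t where "t = n div 27"
  have t: "n < 27 * t + 27" by (simp add: t_def)
  define k where "k = n - 1"
  have nk: "n = k + 1" using n_ge by (simp add: k_def)
  consider "g = 0" | "g = 1" | "g = 2" using assms(3) by linarith
  then show False
  proof cases
    case 1
    then have "54 * (t + 1) \<le> c * (t + 1)" using c by (intro mult_le_mono1) simp
    then have "54 * t + 54 \<le> r" using assms(1) by (simp add: t_def)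
    then show False using 1 assms(2) t by simp
  next
    case 2
    then have "36 * (t + 1) \<le> c * (t + 1)" using c by (intro mult_le_mono1) simp
    then have "36 * t + 36 \<le> r" using assms(1) by (simp add: t_def)
    moreover have "3 * r + 2 * k + 90 \<le> 6 * n" using 2 assms(2) by (simp add: k_def)
    ultimately show False using t nk by linarith
  next
    case 3
    then have "18 * (t + 1) \<le> c * (t + 1)" using c by (intro mult_le_mono1) simp
    then have "18 * t + 18 \<le> r" using assms(1) by (simp add: t_def)
    moreover have "3 * r + 4 * k + 90 \<le> 6 * n" using 3 assms(2) by (simp add: k_def)
    ultimately show False using t nk by linarith
  qed
qed



lemma pack_few_isolated:
  assumes iso: "card {v \<in> V. arc_deg A v = 0} \<le> 186"
  shows "\<exists>H. bij_betw H V V' \<and> (\<forall>u v. (u, v) \<in> A \<longrightarrow> (H u, H v) \<notin> A')"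
proof -
  obtain Z X \<phi> g0 where prep: "prepared Z X \<phi> g0" using prepared_exists by blast
  define P where "P = (\<Union>z\<in>Z. nbrs A z)"
  define r where "r = card (restr A' (V' - X))"
  have Z: "Z \<subseteq> V" "X \<subseteq> V'" "bij_betw \<phi> Z X" "card Z \<le> 2" "Z \<inter> P = {}"
    "inj_on g0 P" "g0 ` P \<subseteq> V' - X" "restr A' (g0 ` P) = {}"
    and low0: "\<And>p. p \<in> P \<Longrightarrow> arc_deg (restr A' (V' - X)) (g0 p) \<le> 9"
    and comp0: "\<And>z p. z \<in> Z \<Longrightarrow> p \<in> nbrs A z \<Longrightarrow> compat A A' z (\<phi> z) p (g0 p)"
    and cP0: "92 * card P \<le> card Z * n"
    and r0: "3 * r + 2 * card X * (n - 1) + 90 \<le> 6 * n"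
    and nogiant: "\<And>x. x \<in> V' - X \<Longrightarrow> \<not> giant x"
    using prep[unfolded prepared_def Let_def, folded P_def r_def] by simp_all
  have PV: "P \<subseteq> V" using nbrs_subset[OF arcs(1)] by (auto simp: P_def)
  have finP: "finite P" "finite Z" "finite X" using PV Z(1,2) fin by (meson finite_subset)+
  define c where "c = card X"
  have cZ: "card Z = c" using Z(3) bij_betw_same_card by (auto simp: c_def)
  have c2: "c \<le> 2" using Z(4) cZ by simp
  define k where "k = n - 1"
  have nk: "n = k + 1" using n_ge by (simp add: k_def)
  define t where "t = n div 27"
  have t: "27 * t \<le> n" "n < 27 * t + 27" by (auto simp: t_def)
  have D: "restr A' (V' - X) \<subseteq> (V' - X) \<times> (V' - X)" by (rule restr_subset)
  obtain Y where Y: "Y \<subseteq> V' - X" "card Y * (t + 1) \<le> r"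
    "\<And>v. v \<in> V' - X - Y \<Longrightarrow> arc_deg (restr (restr A' (V' - X)) (V' - X - Y)) v \<le> t"
    "\<And>y. y \<in> Y \<Longrightarrow> t < arc_deg (restr A' (V' - X)) y"
    using peel[OF _ D, of t] fin unfolding r_def by blast
  have cY: "card Y + 18 * c \<le> 53"
    using card_peeled[of "card Y" r c] Y(2) r0 c2 by (simp add: t_def c_def)
  have finY: "finite Y" using Y(1) fin by (meson finite_Diff finite_subset)
  obtain U where U: "U \<subseteq> V - Z" "93 \<le> card U + card Z"
    and U1: "\<forall>u\<in>U. u \<notin> P \<and> nbrs A u \<subseteq> V - Z - P - U \<and> arc_deg A u \<le> 1"
    and U2: "\<forall>u\<in>U. \<forall>v\<in>U. u \<noteq> v \<longrightarrow> nbrs A u \<inter> nbrs A v = {}"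
    and U3: "\<forall>u\<in>U. \<forall>w\<in>nbrs A u. card (nbrs A w \<inter> (P \<union> (\<Union>u\<in>U. nbrs A u))) \<le> card P + 1"
    using fresh_units[OF prep, folded P_def] by (elim exE conjE) (rule that; assumption)
  have Uu: "u \<notin> P" "nbrs A u \<subseteq> V - Z - P - U" "arc_deg A u \<le> 1" if "u \<in> U" for u
    using U1 that by simp_all
  have Udis: "nbrs A u \<inter> nbrs A v = {}" if "u \<in> U" "v \<in> U" "u \<noteq> v" for u v
    using U2 that by simp
  have Unb: "card (nbrs A w \<inter> (P \<union> (\<Union>u\<in>U. nbrs A u))) \<le> card P + 1" if "u \<in> U" "w \<in> nbrs A u" for u w
    using U3 that by simp
  have finU: "finite U" using U(1) fin by (meson finite_Diff finite_subset)
  have cU: "card Y + 40 \<le> card U" using U(2) cZ cY c2 by linarith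
  obtain UX where UX: "UX \<subseteq> U" "card UX = card Y"
    using obtain_subset_with_card_n[of "card Y" U] cU by auto
  have "20 \<le> card (U - UX)" using UX cU finU by (simp add: card_Diff_subset finite_subset)
  then obtain J1 where J1: "J1 \<subseteq> U - UX" "card J1 = 20" using obtain_subset_with_card_n by metis
  have finUX: "finite UX" "finite J1" using UX J1 finU by (meson finite_Diff finite_subset)+
  have "20 \<le> card (U - UX - J1)" using UX J1 cU finU finUX by (simp add: card_Diff_subset)
  then obtain J2 where J2: "J2 \<subseteq> U - UX - J1" "card J2 = 20" using obtain_subset_with_card_n by metis
  have finJ2: "finite J2" using J2 finU by (meson finite_Diff finite_subset)
  obtain \<psi> where \<psi>: "bij_betw \<psi> UX Y" using finite_same_card_bij[OF finUX(1) finY] UX(2) by auto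
  obtain \<pi> where \<pi>: "bij_betw \<pi> J1 J2" using finite_same_card_bij[OF finUX(2) finJ2] J1(2) J2(2) by auto
  define J where "J = J1 \<union> J2"
  have JU: "J \<subseteq> U" "UX \<inter> J = {}" using J1 J2 by (auto simp: J_def)
  have cJ: "card J = 40"
    unfolding J_def using J1 J2 finUX finJ2 by (subst card_Un_disjoint) auto
  define W where "W S = (\<Union>u\<in>S. nbrs A u)" for S
  have finW: "finite (W S)" if "finite S" for S using that finA by (simp add: W_def finite_nbrs)
  have cN: "card (nbrs A u) \<le> 1" if "u \<in> U" for u
    using card_nbrs_le[OF finA(1), of u] Uu(3)[OF that] by linarith
  have cW: "card (W S) \<le> card S" if "S \<subseteq> U" for S
  proof -
    have "card (W S) \<le> (\<Sum>u\<in>S. card (nbrs A u))"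
      unfolding W_def using that finU by (intro card_UN_le) (meson finite_subset)
    also have "\<dots> \<le> (\<Sum>u\<in>S. 1)" using cN that by (intro sum_mono) auto
    finally show ?thesis by simp
  qed
  have Wdis: "W S \<inter> W S' = {}" if "S \<subseteq> U" "S' \<subseteq> U" "S \<inter> S' = {}" for S S'
    unfolding W_def using Udis that by blast
  have WV: "W S \<subseteq> V - Z - P - U" if "S \<subseteq> U" for S
    using Uu(2) that by (auto simp: W_def)
  have Wnb: "card (nbrs A w \<inter> (P \<union> W S)) \<le> card P + 1" if "w \<in> W U" "S \<subseteq> U" for w S
  proof -
    obtain u where u: "u \<in> U" "w \<in> nbrs A u" using \<open>w \<in> W U\<close> by (auto simp: W_def)
    have "card (nbrs A w \<inter> (P \<union> W S)) \<le> card (nbrs A w \<inter> (P \<union> (\<Union>u\<in>U. nbrs A u)))"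
      using that(2) finite_nbrs[OF finA(1)] by (intro card_mono) (auto simp: W_def)
    then show ?thesis using Unb[OF u] by linarith
  qed
  define V2 where "V2 = V' - X - Y"
  define A2 where "A2 = restr A' V2"
  define Low where "Low = {s \<in> V2. arc_deg A2 s \<le> 9}"
  have finA2: "finite A2" using finA by (simp add: A2_def finite_restr)
  have irr2: "irrefl A2" using irr by (simp add: A2_def irrefl_restr)
  have finV2: "finite V2" "finite Low" using fin by (auto simp: V2_def Low_def)
  have cV2: "card V2 = n - c - card Y"
    using Y(1) Z(2) finP finY card_V by (simp add: V2_def card_Diff_subset c_def)
  have A2': "A2 = restr (restr A' (V' - X)) (V' - X - Y)"
    by (auto simp: A2_def V2_def restr_def)
  have degA2: "arc_deg A2 s \<le> t" if "s \<in> V2" for s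
    using Y(3) that unfolding A2' V2_def by blast
  have nbA2: "card (nbrs A2 s) \<le> t" if "s \<in> V2" for s
    using degA2[OF that] card_nbrs_le[OF finA2, of s] by linarith
  have "card A2 \<le> r"
    unfolding r_def A2' using finA by (intro card_mono restr_subset finite_restr)
  moreover have "10 * card V2 \<le> 10 * card Low + 2 * card A2"
    using card_low[OF finV2(1) finA2, of 9] by (simp add: Low_def)
  ultimately have cLow: "10 * n \<le> 10 * card Low + 10 * c + 10 * card Y + 2 * r"
    using cV2 cY c2 n_ge by linarith
  have lowN: "card (nbrs A2 y) \<le> 9" if "y \<in> Low" for y
    using that card_nbrs_le[OF finA2, of y] by (simp add: Low_def)
  have lowV2: "Low \<subseteq> V2" by (auto simp: Low_def)
  have g0Low: "g0 ` P \<subseteq> Low"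
  proof
    fix y assume "y \<in> g0 ` P"
    then obtain p where p: "p \<in> P" "y = g0 p" by auto
    have "arc_deg (restr A' (V' - X)) y \<le> 9" using low0 p by simp
    moreover then have "y \<notin> Y" using Y(4)[of y] t n_ge by fastforce
    moreover have "arc_deg A2 y \<le> arc_deg (restr A' (V' - X)) y"
      unfolding A2' using finA by (intro arc_deg_restr_le finite_restr)
    ultimately show "y \<in> Low" using p Z(7) by (auto simp: Low_def V2_def)
  qed
  have "v \<in> nbrs A u \<Longrightarrow> g0 v \<notin> nbrs A2 (g0 u)" if "u \<in> P" "v \<in> P" for u v
    using that Z(8) by (force simp: nbrs_def A2_def restr_def)
  then have pl0: "placed A A2 Low P g0" using Z(6) g0Low by (auto simp: placed_def)

  have cnum: "(c = 0 \<and> card P = 0 \<and> card Y \<le> 53 \<and> 3 * r + 90 \<le> 6 * n) \<or>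
    (c = 1 \<and> 92 * card P \<le> n \<and> card Y \<le> 35 \<and> 3 * r + 88 \<le> 4 * n) \<or>
    (c = 2 \<and> 92 * card P \<le> 2 * n \<and> card Y \<le> 17 \<and> 3 * r + 86 \<le> 2 * n)"
  proof -
    consider "c = 0" | "c = 1" | "c = 2" using c2 by linarith
    then show ?thesis
    proof cases
      case 1 then show ?thesis using cP0 cY r0 cZ by (simp add: c_def[symmetric])
    next
      case 2
      then have "3 * r + 2 * k + 90 \<le> 6 * n" using r0 by (simp add: c_def[symmetric] k_def)
      moreover have "92 * card P \<le> n" "card Y \<le> 35" using 2 cP0 cY cZ by simp_all
      ultimately show ?thesis using 2 nk by linarith
    next
      case 3
      then have "3 * r + 4 * k + 90 \<le> 6 * n" using r0 by (simp add: c_def[symmetric] k_def)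
      moreover have "92 * card P \<le> 2 * n" "card Y \<le> 17" using 3 cP0 cY cZ by simp_all
      ultimately show ?thesis using 3 nk by linarith
    qed
  qed

  define Al where "Al w = {y \<in> Low. \<forall>u\<in>UX. w \<in> nbrs A u \<longrightarrow> compat A A' u (\<psi> u) w y}" for w
  have room1: "card (P \<union> W UX) + 9 * card (nbrs A w \<inter> (P \<union> W UX)) \<le> card (Al w)" if w: "w \<in> W UX" for w
  proof -
    obtain u where u: "u \<in> UX" "w \<in> nbrs A u" using w by (auto simp: W_def)
    have uU: "u \<in> U" using u UX by auto
    have \<psi>u: "\<psi> u \<in> Y" using \<psi> u by (auto simp: bij_betw_def)
    have uniq: "u' = u" if "u' \<in> UX" "w \<in> nbrs A u'" for u'
      using Udis[of u' u] that u UX by blast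
    have uw: "u \<noteq> w" using u nbrs_irrefl[OF irr(1)] by auto
    define C where "C = (if (u, w) \<in> A then out_free A' V' (\<psi> u) else out_free (A'\<inverse>) V' (\<psi> u))"
    have not2: "\<not> ((u, w) \<in> A \<and> (w, u) \<in> A)"
    proof
      assume "(u, w) \<in> A \<and> (w, u) \<in> A"
      then have "{(u, w), (w, u)} \<subseteq> {e \<in> A. fst e = u \<or> snd e = u}" by auto
      then have "card {(u, w), (w, u)} \<le> arc_deg A u"
        unfolding arc_deg_def using finA by (intro card_mono) auto
      then show False using Uu(3)[OF uU] uw by simp
    qed
    have "C \<inter> Low \<subseteq> Al w"
    proof
      fix y assume y: "y \<in> C \<inter> Low"
      have "compat A A' u (\<psi> u) w y"
      proof (cases "(u, w) \<in> A")
        case True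
        then show ?thesis using y not2 by (simp add: C_def compat_def out_free_def)
      next
        case False
        then show ?thesis using y by (simp add: C_def compat_def out_free_def)
      qed
      then have "\<forall>u'\<in>UX. w \<in> nbrs A u' \<longrightarrow> compat A A' u' (\<psi> u') w y" using uniq by blast
      then show "y \<in> Al w" using y by (simp add: Al_def)
    qed
    then have "card (C \<inter> Low) \<le> card (Al w)"
      using finV2 by (intro card_mono) (auto simp: Al_def)
    moreover have "14 * n \<le> 30 * card (C \<inter> Low) + 30 * card X + 30 * card Y + 6 * r + 12 * card X + 6"
      unfolding Low_def A2_def V2_def r_def
    proof (rule not_giant_room)
      show "\<psi> u \<in> V'" "\<psi> u \<notin> X" "\<not> giant (\<psi> u)" using \<psi>u Y(1) nogiant by auto
      show "C = out_free A' V' (\<psi> u) \<or> C = out_free (A'\<inverse>) V' (\<psi> u)" by (simp add: C_def)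
    qed (use Z(2) Y(1) \<psi>u in auto)
    ultimately have "14 * n \<le> 30 * card (Al w) + 42 * c + 30 * card Y + 6 * r + 6"
      unfolding c_def by linarith
    moreover have "card (P \<union> W UX) \<le> card P + card Y"
      using card_Un_le[of P "W UX"] cW[OF UX(1)] UX(2) by linarith
    moreover have "card (nbrs A w \<inter> (P \<union> W UX)) \<le> card P + 1"
      using Wnb[OF _ UX(1)] w UX(1) by (auto simp: W_def)
    ultimately show ?thesis using cnum n_ge by (elim disjE conjE) linarith+
  qed
  have AlLow: "Al w \<subseteq> Low" for w by (auto simp: Al_def)
  have disP: "W S \<inter> P = {}" if "S \<subseteq> U" for S using WV[OF that] by auto
  obtain f1 where f1: "placed A A2 Low (P \<union> W UX) f1" "\<And>v. v \<in> P \<Longrightarrow> f1 v = g0 v"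
    "\<And>w. w \<in> W UX \<Longrightarrow> f1 w \<in> Al w"
    using placed_extend[OF finW[OF finUX(1)] pl0 finP(1) disP[OF UX(1)] finV2(2) finA2 irr(1) lowN AlLow room1]
    by blast
  have J1U: "J1 \<subseteq> U" and J2U: "J2 \<subseteq> U" using J1 J2 by auto
  define L1 L2 L3 where "L1 = P \<union> W UX" and "L2 = L1 \<union> W J1" and "L3 = L2 \<union> W J2"
  have finL: "finite L1" "finite L2" "finite L3"
    using finP finW finUX finJ2 by (auto simp: L1_def L2_def L3_def)
  have W12: "L2 = P \<union> W (UX \<union> J1)" "L3 = P \<union> W (UX \<union> J1 \<union> J2)"
    by (auto simp: L1_def L2_def L3_def W_def)
  have cL3: "card L3 \<le> card P + card Y + 40"
  proof -
    have "card L3 \<le> card P + card (W UX) + card (W J1) + card (W J2)"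
      unfolding L3_def L2_def L1_def by (meson add_le_mono1 card_Un_le order_trans)
    then show ?thesis using cW[OF UX(1)] cW[OF J1U] cW[OF J2U] UX(2) J1(2) J2(2) by linarith
  qed
  have cL2: "card L2 \<le> card L3" using finL by (intro card_mono) (auto simp: L3_def)
  have nL2: "card (nbrs A w \<inter> L2) \<le> card P + 1" if "w \<in> W U" for w
    unfolding W12 using Wnb[OF that, of "UX \<union> J1"] UX J1U by auto
  have nL3: "card (nbrs A w \<inter> L3) \<le> card P + 1" if "w \<in> W U" for w
    unfolding W12 using Wnb[OF that, of "UX \<union> J1 \<union> J2"] UX J1U J2U by auto
  have lowbig: "card L3 + 9 * card P + 9 + 9 * t \<le> card Low"
    using cnum cLow cL3 t n_ge by (elim disjE conjE) linarith+
  have dis2: "W J1 \<inter> L1 = {}"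
    using disP[OF J1U] Wdis[OF J1U UX(1)] J1 by (auto simp: L1_def)
  have room2: "card (L1 \<union> W J1) + 9 * card (nbrs A w \<inter> (L1 \<union> W J1)) \<le> card Low" if "w \<in> W J1" for w
  proof -
    have "w \<in> W U" using that J1U by (auto simp: W_def)
    then show ?thesis using nL2[of w] cL2 lowbig unfolding L2_def[symmetric] by linarith
  qed
  obtain f2 where f2: "placed A A2 Low L2 f2" "\<And>v. v \<in> L1 \<Longrightarrow> f2 v = f1 v"
    using placed_extend[OF finW[OF finUX(2)] f1(1)[folded L1_def] finL(1) dis2 finV2(2) finA2 irr(1) lowN _ room2]
    unfolding L2_def by blast
  txt \<open>
    Each unit in \<open>J2\<close> keeps its placed neighbourhood disjoint from that of its partner in \<open>J1\<close>, so that
    no target can be adjacent to the neighbours of more than half of the units in \<open>J\<close>.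
  \<close>
  define Bl where "Bl w = {y \<in> Low. \<forall>u\<in>J1. w \<in> nbrs A (\<pi> u) \<longrightarrow>
      (\<forall>w1\<in>nbrs A u. nbrs A2 y \<inter> nbrs A2 (f2 w1) = {})}" for w
  have \<pi>J: "\<pi> u \<in> J2" if "u \<in> J1" for u using \<pi> that by (auto simp: bij_betw_def)
  have cBl: "card Low \<le> card (Bl w) + 9 * t" if w: "w \<in> W J2" for w
  proof -
    obtain u2 where u2: "u2 \<in> J2" "w \<in> nbrs A u2" using w by (auto simp: W_def)
    obtain u where u: "u \<in> J1" "u2 = \<pi> u" using u2 \<pi> by (auto simp: bij_betw_def)
    have uniq: "u' = u" if "u' \<in> J1" "w \<in> nbrs A (\<pi> u')" for u'
    proof -
      have "\<pi> u' = \<pi> u" using Udis[of "\<pi> u'" u2] that u u2 \<pi>J J2U by blast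
      then show ?thesis using \<pi> that u by (auto simp: bij_betw_def inj_on_def)
    qed
    define E where "E = (\<Union>w1\<in>nbrs A u. \<Union>s\<in>nbrs A2 (f2 w1). nbrs A2 s)"
    have finN: "finite (nbrs A2 s)" for s using finA2 by (rule finite_nbrs)
    have fu: "f2 w1 \<in> Low" if "w1 \<in> nbrs A u" for w1
      using f2(1) that u(1) by (auto simp: placed_def L2_def W_def)
    have "card (\<Union>s\<in>nbrs A2 (f2 w1). nbrs A2 s) \<le> 9 * t" if "w1 \<in> nbrs A u" for w1
    proof -
      have "card (\<Union>s\<in>nbrs A2 (f2 w1). nbrs A2 s) \<le> (\<Sum>s\<in>nbrs A2 (f2 w1). card (nbrs A2 s))"
        by (rule card_UN_le[OF finN])
      also have "\<dots> \<le> (\<Sum>s\<in>nbrs A2 (f2 w1). t)"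
      proof (rule sum_mono)
        fix s assume "s \<in> nbrs A2 (f2 w1)"
        then have "s \<in> V2" using nbrs_subset[of A2 V2] by (auto simp: A2_def restr_def)
        then show "card (nbrs A2 s) \<le> t" by (rule nbA2)
      qed
      also have "\<dots> = card (nbrs A2 (f2 w1)) * t" by simp
      also have "\<dots> \<le> 9 * t" using lowN[OF fu[OF that]] by (rule mult_le_mono1)
      finally show ?thesis .
    qed
    then have "(\<Sum>w1\<in>nbrs A u. card (\<Union>s\<in>nbrs A2 (f2 w1). nbrs A2 s)) \<le> (\<Sum>w1\<in>nbrs A u. 9 * t)"
      by (rule sum_mono)
    moreover have "card E \<le> (\<Sum>w1\<in>nbrs A u. card (\<Union>s\<in>nbrs A2 (f2 w1). nbrs A2 s))"
      unfolding E_def by (rule card_UN_le[OF finite_nbrs[OF finA(1)]])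
    moreover have "(\<Sum>w1\<in>nbrs A u. 9 * t) = card (nbrs A u) * (9 * t)" by simp
    moreover have "card (nbrs A u) * (9 * t) \<le> 1 * (9 * t)" using cN u J1U by (intro mult_le_mono1) auto
    ultimately have cE: "card E \<le> 9 * t" by linarith
    have "Low \<subseteq> Bl w \<union> E"
    proof
      fix y assume y: "y \<in> Low"
      show "y \<in> Bl w \<union> E"
      proof (cases "y \<in> E")
        case False
        have "nbrs A2 y \<inter> nbrs A2 (f2 w1) = {}" if "u' \<in> J1" "w \<in> nbrs A (\<pi> u')" "w1 \<in> nbrs A u'" for u' w1
        proof (rule ccontr)
          assume "nbrs A2 y \<inter> nbrs A2 (f2 w1) \<noteq> {}"
          then obtain s where "s \<in> nbrs A2 y" "s \<in> nbrs A2 (f2 w1)" by auto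
          then have "y \<in> nbrs A2 s" "s \<in> nbrs A2 (f2 w1)" using nbrs_sym by metis+
          then have "y \<in> E" using that uniq by (auto simp: E_def)
          then show False using False by simp
        qed
        then show ?thesis using y by (auto simp: Bl_def)
      qed simp
    qed
    then have "card Low \<le> card (Bl w \<union> E)"
      using finV2 finN finA by (intro card_mono) (auto simp: Bl_def E_def finite_nbrs)
    then show ?thesis using card_Un_le[of "Bl w" E] cE by linarith
  qed
  have dis3: "W J2 \<inter> L2 = {}"
    using disP[OF J2U] Wdis[OF J2U UX(1)] Wdis[OF J2U J1U] J2 by (auto simp: L1_def L2_def)
  have room3: "card (L2 \<union> W J2) + 9 * card (nbrs A w \<inter> (L2 \<union> W J2)) \<le> card (Bl w)" if "w \<in> W J2" for w
  proof -
    have "w \<in> W U" using that J2U by (auto simp: W_def)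
    then show ?thesis using nL3[of w] cBl[OF that] lowbig unfolding L3_def[symmetric] by linarith
  qed
  have BlLow: "Bl w \<subseteq> Low" for w by (auto simp: Bl_def)
  obtain f3 where f3: "placed A A2 Low L3 f3" "\<And>v. v \<in> L2 \<Longrightarrow> f3 v = f2 v" "\<And>w. w \<in> W J2 \<Longrightarrow> f3 w \<in> Bl w"
    using placed_extend[OF finW[OF finJ2] f2(1) finL(2) dis3 finV2(2) finA2 irr(1) lowN BlLow room3]
    unfolding L3_def by blast

  have excess: "(\<Sum>v\<in>V. arc_deg A v - 1) \<le> n" by (rule sum_excess_degree[OF iso])
  define S1 where "S1 = {v \<in> V - Z. 60 < arc_deg A v} - L3"
  define S2 where "S2 = {v \<in> V - Z. 4 < arc_deg A v} - (L3 \<union> S1)"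
  have finS: "finite S1" "finite S2" using fin by (auto simp: S1_def S2_def)
  have "card S1 * 60 \<le> (\<Sum>v\<in>V. arc_deg A v - 1)"
    by (rule card_mult_le_sum[OF fin(1)]) (auto simp: S1_def)
  then have cS1: "60 * card S1 \<le> n" using excess by linarith
  have "card (S1 \<union> S2) * 4 \<le> (\<Sum>v\<in>V. arc_deg A v - 1)"
    by (rule card_mult_le_sum[OF fin(1)]) (auto simp: S1_def S2_def)
  then have cS: "4 * card (S1 \<union> S2) \<le> n" using excess by linarith
  define L4 L where "L4 = L3 \<union> S1" and "L = L4 \<union> S2"
  have finL4: "finite L4" "finite L" using finL finS by (auto simp: L4_def L_def)
  have cL4: "card L4 \<le> card L3 + card S1" unfolding L4_def by (rule card_Un_le)
  have "L = L3 \<union> (S1 \<union> S2)" by (auto simp: L_def L4_def)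
  then have cL: "card L \<le> card L3 + card (S1 \<union> S2)" by (simp add: card_Un_le)
  have low4: "10 * card L4 \<le> card Low"
    using cnum cLow cL3 cL4 cS1 n_ge by (elim disjE conjE) linarith+
  have low5: "card L + 540 \<le> card Low"
    using cnum cLow cL3 cL cS n_ge by (elim disjE conjE) linarith+
  have room4: "card (L3 \<union> S1) + 9 * card (nbrs A v \<inter> (L3 \<union> S1)) \<le> card Low" for v
  proof -
    have "card (nbrs A v \<inter> L4) \<le> card L4" using finL4 by (intro card_mono) auto
    then show ?thesis using low4 unfolding L4_def[symmetric] by linarith
  qed
  have dis4: "S1 \<inter> L3 = {}" by (auto simp: S1_def)
  obtain f4 where f4: "placed A A2 Low L4 f4" "\<And>v. v \<in> L3 \<Longrightarrow> f4 v = f3 v"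
    using placed_extend[OF finS(1) f3(1) finL(3) dis4 finV2(2) finA2 irr(1) lowN order_refl room4]
    unfolding L4_def by blast
  have room5: "card (L4 \<union> S2) + 9 * card (nbrs A v \<inter> (L4 \<union> S2)) \<le> card Low" if "v \<in> S2" for v
  proof -
    have "arc_deg A v \<le> 60" using that by (auto simp: S1_def S2_def)
    then have "card (nbrs A v) \<le> 60" using card_nbrs_le[OF finA(1), of v] by linarith
    then have "card (nbrs A v \<inter> L) \<le> 60"
      using card_mono[OF finite_nbrs[OF finA(1)], of "nbrs A v \<inter> L" v] by auto
    then show ?thesis using low5 unfolding L_def[symmetric] by linarith
  qed
  have dis5: "S2 \<inter> L4 = {}" by (auto simp: S2_def L4_def)
  obtain f where f: "placed A A2 Low L f" "\<And>v. v \<in> L4 \<Longrightarrow> f v = f4 v"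
    using placed_extend[OF finS(2) f4(1) finL4(1) dis5 finV2(2) finA2 irr(1) lowN _ room5]
    unfolding L_def by blast
  have sub: "P \<subseteq> L1" "L1 \<subseteq> L2" "L2 \<subseteq> L3" "L3 \<subseteq> L4" "L4 \<subseteq> L"
    by (auto simp: L1_def L2_def L3_def L4_def L_def)
  have fP: "f p = g0 p" if "p \<in> P" for p
    using that sub f1(2) f2(2) f3(2) f4(2) f(2) by (metis subsetD)
  have fX: "f w \<in> Al w" if "w \<in> W UX" for w
  proof -
    have "w \<in> L1" using that by (simp add: L1_def)
    then have "f w = f1 w" using sub f2(2) f3(2) f4(2) f(2) by (metis subsetD)
    then show ?thesis using f1(3) that by simp
  qed
  have fJ1: "f w = f2 w" if "w \<in> W J1" for w
  proof -
    have "w \<in> L2" using that by (simp add: L2_def)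
    then show ?thesis using sub f3(2) f4(2) f(2) by (metis subsetD)
  qed
  have fJ2: "f w \<in> Bl w" if "w \<in> W J2" for w
  proof -
    have "w \<in> L3" using that by (simp add: L3_def)
    then have "f w = f3 w" using sub f4(2) f(2) by (metis subsetD)
    then show ?thesis using f3(3) that by simp
  qed
  have L3V: "L3 \<subseteq> V - Z - U"
  proof -
    have "P \<subseteq> V - Z - U" using PV Z(5) Uu(1) by blast
    then show ?thesis using WV[OF UX(1)] WV[OF J1U] WV[OF J2U] by (auto simp: L1_def L2_def L3_def)
  qed
  have SV: "S1 \<union> S2 \<subseteq> V - Z - U" using Uu(3) by (fastforce simp: S1_def S2_def)
  have LV: "L \<subseteq> V - Z - U" using L3V SV by (auto simp: L4_def L_def)
  define ZZ where "ZZ = Z \<union> UX"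
  have cZZ: "card (V - ZZ) = card V2"
  proof -
    have "card ZZ = c + card Y" unfolding ZZ_def using UX U(1) finP finUX cZ
      by (subst card_Un_disjoint) auto
    moreover have "ZZ \<subseteq> V" using Z(1) UX U(1) by (auto simp: ZZ_def)
    ultimately show ?thesis using finP finUX card_V cV2 by (simp add: card_Diff_subset ZZ_def)
  qed
  have "\<exists>h. bij_betw h (V - ZZ) V2 \<and> (\<forall>w\<in>L. h w = f w) \<and>
    (\<forall>u\<in>V - ZZ. \<forall>v\<in>V - ZZ. v \<in> nbrs A u \<longrightarrow> h v \<notin> nbrs A2 (h u))"
  proof (rule complete_placing[where T = 9 and J = J and d = 4 and t = t and P = "3 * n div 10"])
    show "L \<subseteq> V - ZZ" using LV UX(1) by (auto simp: ZZ_def)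
    show "J \<subseteq> V - ZZ" using JU U(1) by (auto simp: ZZ_def)
    show "L \<inter> J = {}" using LV JU by auto
    show "placed A A2 V2 L f" using f(1) lowV2 by (auto simp: placed_def)
    show "card (nbrs A2 (f w)) \<le> 9" if "w \<in> L" for w
      using that f(1) lowN by (auto simp: placed_def)
    show "nbrs A u \<subseteq> L" if "u \<in> J" for u
      using that sub by (auto simp: J_def L2_def L3_def W_def)
    show "card (nbrs A u) \<le> 1" if "u \<in> J" for u using cN that JU by auto
    show "2 * card {u \<in> J. \<exists>w\<in>nbrs A u. s \<in> nbrs A2 (f w)} \<le> card J" for s
    proof -
      define B1 where "B1 = {u \<in> J1. \<exists>w\<in>nbrs A u. s \<in> nbrs A2 (f w)}"
      define B2 where "B2 = {u \<in> J2. \<exists>w\<in>nbrs A u. s \<in> nbrs A2 (f w)}"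
      have "\<pi> u \<notin> B2" if u: "u \<in> B1" for u
      proof
        assume "\<pi> u \<in> B2"
        then obtain w2 where w2: "w2 \<in> nbrs A (\<pi> u)" "s \<in> nbrs A2 (f w2)" by (auto simp: B2_def)
        obtain w1 where w1: "u \<in> J1" "w1 \<in> nbrs A u" "s \<in> nbrs A2 (f w1)" using u by (auto simp: B1_def)
        have "f w2 \<in> Bl w2" using fJ2[of w2] w2(1) \<pi>J[OF w1(1)] by (auto simp: W_def)
        moreover have "f w1 = f2 w1" using fJ1[of w1] w1 by (auto simp: W_def)
        ultimately show False using w1 w2 by (auto simp: Bl_def)
      qed
      then have "\<pi> ` B1 \<inter> B2 = {}" by auto
      moreover have "\<pi> ` B1 \<union> B2 \<subseteq> J2" using \<pi>J by (auto simp: B1_def B2_def)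
      moreover have "finite B1" "finite B2" using finUX finJ2 by (auto simp: B1_def B2_def)
      ultimately have "card (\<pi> ` B1) + card B2 \<le> 20"
        using card_mono[OF finJ2, of "\<pi> ` B1 \<union> B2"] J2(2) by (simp add: card_Un_disjoint)
      moreover have "card (\<pi> ` B1) = card B1"
      proof (rule card_image)
        show "inj_on \<pi> B1" using \<pi> by (auto simp: bij_betw_def B1_def inj_on_def)
      qed
      moreover have "{u \<in> J. \<exists>w\<in>nbrs A u. s \<in> nbrs A2 (f w)} = B1 \<union> B2"
        by (auto simp: J_def B1_def B2_def)
      ultimately show ?thesis using card_Un_le[of B1 B2] cJ by simp
    qed
    show "card (nbrs A v) \<le> 4" if "v \<in> V - ZZ - L - J" for v
    proof -
      have "arc_deg A v \<le> 4"
        using that by (auto simp: S2_def L_def L4_def ZZ_def)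
      then show ?thesis using card_nbrs_le[OF finA(1), of v] by linarith
    qed
    show "card (nbrs A2 s) \<le> t" if "s \<in> V2" for s using nbA2 that .
    have "(\<Sum>w\<in>L. card (nbrs A w)) \<le> (\<Sum>w\<in>L. (arc_deg A w - 1) + 1)"
      using card_nbrs_le[OF finA(1)] by (intro sum_mono) (meson le_diff_conv order_refl order_trans)
    also have "\<dots> = (\<Sum>w\<in>L. arc_deg A w - 1) + card L" by (simp only: sum.distrib card_eq_sum)
    also have "(\<Sum>w\<in>L. arc_deg A w - 1) \<le> (\<Sum>v\<in>V. arc_deg A v - 1)"
      using LV fin by (intro sum_mono2) auto
    finally have sL: "(\<Sum>w\<in>L. card (nbrs A w)) \<le> n + card L" using excess by linarith
    have d10: "3 * n < 10 * (3 * n div 10) + 10" "10 * (3 * n div 10) \<le> 3 * n" by simp_all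
    have "9 * n + 9 * card L < 41 * (3 * n div 10) + 41"
      using cnum cL3 cL cS d10 n_ge by (elim disjE conjE) linarith+
    then show "9 * (\<Sum>w\<in>L. card (nbrs A w)) < (card J + 1) * (3 * n div 10 + 1)"
      using sL cJ by simp
    show "card L + card J + 4 * 9 + 3 * n div 10 + 2 * 4 * t + 4 < card (V - ZZ)"
      using cnum cL3 cL cS d10 n_ge cZZ cV2 cJ t by (elim disjE conjE) linarith+
  qed (use fin finV2 finA finA2 irr irr2 cJ cZZ in auto)
  then obtain h where h: "bij_betw h (V - ZZ) V2" "\<And>w. w \<in> L \<Longrightarrow> h w = f w"
    "\<And>u v. u \<in> V - ZZ \<Longrightarrow> v \<in> V - ZZ \<Longrightarrow> v \<in> nbrs A u \<Longrightarrow> h v \<notin> nbrs A2 (h u)" by blast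
  define \<Phi> where "\<Phi> v = (if v \<in> Z then \<phi> v else \<psi> v)" for v
  have ZUX: "Z \<inter> UX = {}" using UX(1) U(1) by auto
  have "bij_betw \<Phi> Z X" by (rule bij_betw_cong[THEN iffD2, OF _ Z(3)]) (simp add: \<Phi>_def)
  moreover have "bij_betw \<Phi> UX Y"
    by (rule bij_betw_cong[THEN iffD2, OF _ \<psi>]) (use ZUX in \<open>auto simp: \<Phi>_def\<close>)
  ultimately have b\<Phi>: "bij_betw \<Phi> ZZ (X \<union> Y)"
    unfolding ZZ_def by (rule bij_betw_combine) (use Y(1) in auto)
  have VXY: "V' - (X \<union> Y) = V2" by (auto simp: V2_def)
  show ?thesis
  proof (rule combine_packing[OF arcs(1) _ _ b\<Phi>])
    show "ZZ \<subseteq> V" "X \<union> Y \<subseteq> V'" using Z(1,2) UX(1) U(1) Y(1) by (auto simp: ZZ_def)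
    show "bij_betw h (V - ZZ) (V' - (X \<union> Y))" using h(1) VXY by simp
    show "ZZ \<inter> (\<Union>z\<in>ZZ. nbrs A z) = {}"
    proof -
      have "(\<Union>z\<in>ZZ. nbrs A z) = P \<union> W UX" by (auto simp: ZZ_def P_def W_def)
      moreover have "P \<union> W UX \<subseteq> V - Z - U" using L3V sub by (auto simp: L1_def)
      ultimately show ?thesis using UX(1) by (auto simp: ZZ_def)
    qed
    show "compat A A' z (\<Phi> z) p (h p)" if z: "z \<in> ZZ" "p \<in> nbrs A z" for z p
    proof (cases "z \<in> Z")
      case True
      then have p: "p \<in> P" using z by (auto simp: P_def)
      then have "p \<in> L" using sub by (meson subsetD)
      then have "h p = g0 p" using h(2)[of p] fP[OF p] by simp
      then show ?thesis using comp0[OF True z(2)] True by (simp add: \<Phi>_def)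
    next
      case False
      then have zU: "z \<in> UX" using z by (simp add: ZZ_def)
      then have p: "p \<in> W UX" using z by (auto simp: W_def)
      then have "p \<in> L1" by (simp add: L1_def)
      then have "p \<in> L" using sub by (meson subsetD)
      then have "h p = f p" using h(2)[of p] by simp
      then show ?thesis using fX[OF p] zU z False by (auto simp: Al_def \<Phi>_def)
    qed
    show "h v \<notin> nbrs (restr A' (V' - (X \<union> Y))) (h u)"
      if "u \<in> V - ZZ" "v \<in> V - ZZ" "v \<in> nbrs A u" for u v
      using h(3)[OF that] VXY by (simp add: A2_def)
  qed
qed

lemma pack_exists: "\<exists>H. bij_betw H V V' \<and> (\<forall>u v. (u, v) \<in> A \<longrightarrow> (H u, H v) \<notin> A')"
proof (cases "card {v \<in> V. arc_deg A v = 0} \<le> 186")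
  case True
  then show ?thesis by (rule pack_few_isolated)
next
  case False
  then show ?thesis by (intro pack_many_isolated[of "{v \<in> V. arc_deg A v = 0}"]) auto
qed

end

section \<open>The value of \<open>mu\<close>\<close>

lemma pair_digraph_facts:
  assumes "pair_digraph D"
  shows "finite (pverts D)" "parcs D \<subseteq> pverts D \<times> pverts D" "irrefl (parcs D)"
proof -
  interpret pair_digraph D by fact
  show "finite (pverts D)" by (rule pair_finite_verts)
  show "parcs D \<subseteq> pverts D \<times> pverts D" using in_arcsD1 in_arcsD2 by auto
  show "irrefl (parcs D)" using pair_no_loops by (force simp: irrefl_def)
qed

lemma mu_ge:
  assumes "93 \<le> m" "31 * m \<le> n"
  shows "2 * n \<le> mu n (n - m) + n div m"
proof (rule ccontr)
  assume less: "\<not> ?thesis"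
  have k: "1 \<le> n - m" "n - m \<le> n * (n - 1)"
  proof -
    show "1 \<le> n - m" using assms by linarith
    have "n - m \<le> n * 1" by simp
    also have "\<dots> \<le> n * (n - 1)" using assms by (intro mult_le_mono2) linarith
    finally show "n - m \<le> n * (n - 1)" .
  qed
  obtain D D' :: "nat pair_pre_digraph" where D: "pair_digraph D" "pair_digraph D'"
    "card (pverts D) = n" "card (pverts D') = n" "card (parcs D) = n - m"
    "card (parcs D') = mu n (n - m)" "\<not> pack D D'"
    using mu_attained[OF k] by blast
  interpret digraph_pair "pverts D" "pverts D'" "parcs D" "parcs D'" n m
    using pair_digraph_facts[OF D(1)] pair_digraph_facts[OF D(2)] D(3-6) assms less
    by unfold_locales auto
  obtain H where "bij_betw H (pverts D) (pverts D')"
    "\<forall>u v. (u, v) \<in> parcs D \<longrightarrow> (H u, H v) \<notin> parcs D'"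
    using pack_exists by blast
  then have "packing D D' H" by (auto simp: packing_def bij_betw_def)
  then show False using D(7) by (auto simp: pack_def)
qed

text \<open>
  The vertex sent to \<open>0\<close> cannot be a leaf \<open>v \<ge> m\<close>, as every in-arc of \<open>0\<close> is present, nor a centre \<open>v < m\<close>,
  as it has at least \<open>q - 1\<close> out-neighbours and only \<open>q - 2\<close> out-arcs of \<open>0\<close> are missing.
\<close>

lemma mu_le_stars:
  assumes "1 \<le> m" "2 * m \<le> n"
  shows "mu n (n - m) + n div m \<le> 2 * n"
proof -
  define q where "q = n div m"
  have "2 * m div m \<le> n div m" using assms(2) by (rule div_le_mono)
  then have q2: "2 \<le> q" using assms(1) by (simp add: q_def)
  have qm: "m * q \<le> n" by (simp add: q_def)
  have "1 * q \<le> m * q" using assms(1) by (intro mult_le_mono1)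
  then have qn: "q \<le> n" using qm by linarith
  define D where "D = \<lparr>pverts = {..<n}, parcs = (\<lambda>v. (v mod m, v)) ` {m..<n}\<rparr>"
  define D' where "D' = \<lparr>pverts = {..<n}, parcs = (\<lambda>v. (v, 0)) ` {1..<n} \<union> Pair 0 ` {1..<n + 2 - q}\<rparr>"
  have mod: "v mod m < m" for v using assms(1) by simp
  have wf: "pair_digraph D"
  proof
    fix e assume "e \<in> parcs D"
    then obtain v where v: "e = (v mod m, v)" "m \<le> v" "v < n" by (auto simp: D_def)
    have "v mod m < v" using mod[of v] v(2) by linarith
    then show "fst e \<in> pverts D" "snd e \<in> pverts D" "fst e \<noteq> snd e"
      using v by (auto simp: D_def)
  qed (auto simp: D_def)
  have wf': "pair_digraph D'"
    using q2 by unfold_locales (auto simp: D'_def)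
  have cD: "card (parcs D) = n - m"
    by (simp add: D_def card_image inj_on_def)
  have "card (parcs D') = (n - 1) + (n + 2 - q - 1)"
  proof -
    have "((\<lambda>v. (v, 0)) ` {1..<n}) \<inter> (Pair 0 ` {1..<n + 2 - q}) = {}" by auto
    then show ?thesis by (simp add: D'_def card_Un_disjoint card_image inj_on_def)
  qed
  then have cD': "card (parcs D') + q = 2 * n" using q2 qn assms by linarith
  have "\<not> pack D D'"
  proof
    assume "pack D D'"
    then obtain f where f: "f ` {..<n} \<subseteq> {..<n}" "inj_on f {..<n}"
      "\<And>u v. (u, v) \<in> parcs D \<Longrightarrow> (f u, f v) \<notin> parcs D'"
      by (auto simp: pack_def packing_def D_def D'_def)
    have "f ` {..<n} = {..<n}" using f(1,2) by (simp add: endo_inj_surj)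
    moreover have "0 \<in> {..<n}" using assms by simp
    ultimately obtain u where u: "u < n" "f u = 0" by (metis imageE lessThan_iff)
    have fpos: "f v \<in> {1..<n}" if "v < n" "v \<noteq> u" for v
    proof -
      have "f v \<noteq> f u" using f(2) that u(1) by (auto simp: inj_on_def)
      then show ?thesis using f(1) that u(2) by (auto simp: image_subset_iff)
    qed
    show False
    proof (cases "m \<le> u")
      case True
      have "u mod m < u" using mod[of u] True by linarith
      then have "(f (u mod m), 0) \<in> parcs D'" using fpos[of "u mod m"] u(1) by (auto simp: D'_def)
      moreover have "(u mod m, u) \<in> parcs D" using True u(1) by (auto simp: D_def)
      ultimately show False using f(3) u(2) by metis
    next
      case False
      define S where "S = (\<lambda>j. u + m * j) ` {1..<q}"
      have Sn: "v < n \<and> v \<noteq> u \<and> (u, v) \<in> parcs D" if v: "v \<in> S" for v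
      proof -
        obtain j where j': "v = u + m * j" "j \<in> {1..<q}" using v unfolding S_def by blast
        then have j: "v = u + m * j" "1 \<le> j" "j < q" by simp_all
        have "m * (j + 1) \<le> m * q" using j(3) by (intro mult_le_mono2) simp
        then have "v < n" using j(1) False qm by (simp add: algebra_simps)
        moreover have mj: "m * 1 \<le> m * j" using j(2) by (intro mult_le_mono2)
        moreover have "m \<le> v" "v \<noteq> u" using mj j(1) assms(1) by linarith+
        moreover have "v mod m = u" using j(1) False by simp
        ultimately show ?thesis by (auto simp: D_def)
      qed
      have cS: "card S = q - 1"
        unfolding S_def using assms(1) by (subst card_image) (auto simp: inj_on_def)
      have "f ` S \<subseteq> {n + 2 - q..<n}"
      proof
        fix y assume "y \<in> f ` S"
        then obtain v where v: "v \<in> S" "y = f v" by auto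
        have "y \<in> {1..<n}" using fpos Sn[OF v(1)] v(2) by auto
        moreover have "(0, y) \<notin> parcs D'" using f(3)[of u v] Sn[OF v(1)] u(2) v(2) by simp
        ultimately show "y \<in> {n + 2 - q..<n}" by (auto simp: D'_def)
      qed
      then have "card (f ` S) \<le> n - (n + 2 - q)" using card_mono[of "{n + 2 - q..<n}" "f ` S"] by simp
      moreover have "card (f ` S) = card S"
        using f(2) Sn by (intro card_image) (auto simp: inj_on_def)
      ultimately show False using cS q2 qn by linarith
    qed
  qed
  then have "mu n (card (parcs D)) \<le> card (parcs D')"
    by (intro mu_le[OF wf wf']) (auto simp: D_def D'_def)
  then show ?thesis using cD cD' by (simp add: q_def)
qed

theorem theorem2:
  fixes m n :: nat
  assumes "m \<ge> 93" and "n \<ge> 31 * m"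
  shows "int (mu n (n - m)) = 2 * int n - \<lfloor>real n / real m\<rfloor>"
proof -
  have "mu n (n - m) + n div m = 2 * n"
    using mu_ge[OF assms] mu_le_stars[of m n] assms by linarith
  then show ?thesis by (simp add: floor_divide_of_nat_eq)
qed

end
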